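(* Let $r,s$ be non-negative integers which are not both equal to $0$. For all integers $l_i\geq 2$ ($1\leq i\leq r$), $m_j\geq 2$ ($1\leq j\leq s$) and $k\geq 2+\sum_{i=1}^{r}\left(\lfloor l_i/2\rfloor+1\right)+\sum_{j=1}^{s}m_j$, we have $$\operatorname{bgr}_k\left(P_5:\ \bigcup_{i=1}^{r}P_{l_i}\cup\bigcup_{j=1}^{s}C_{2m_j}\right)=k\left(\sum_{i=1}^{r}\lfloor l_i/2\rfloor+\sum_{j=1}^{s}m_j\right)-k+1.$$
   Context: All graphs are finite, simple and undirected. $P_n$ and $C_n$ denote the path and the cycle on $n$ vertices, and $\cup$, $\bigcup$ denote the (vertex-)disjoint union of graphs. A $k$-edge-coloring (not necessarily proper) is exact if all $k$ colors are used at least once. A copy of a graph in an edge-colored graph is a (not necessarily induced) subgraph isomorphic to it; it is rainbow if no two of its edges have the same color and monochromatic if all its edges have the same color. The $k$-colored bipartite Gallai-Ramsey number $\operatorname{bgr}_k(G:H)$ is the minimum integer $n$ such that $n^2\geq k$ and for every $N\geq n$, every exact $k$-edge-coloring of the complete bipartite graph $K_{N,N}$ contains either a rainbow copy of $G$ or a monochromatic copy of $H$.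
   Formalization: The case r=1, s=0, l_1≤3 (the target is a single P_2 or P_3) is excluded: there the formula gives the value 1, while k≥4 and the definition of bgr requires n^2≥k, so the stated equality fails for every such k. *)

theory Defs
  imports Main "HOL-Library.Extended_Nat"
begin

(* A graph is a pair of a vertex set and a set of edges, an edge being the set of its two ends. *)
type_synonym 'a graph = "'a set \<times> 'a set set"

abbreviation verts :: "'a graph \<Rightarrow> 'a set" where "verts G \<equiv> fst G"
abbreviation edges :: "'a graph \<Rightarrow> 'a set set" where "edges G \<equiv> snd G"

definition simple_graph :: "'a graph \<Rightarrow> bool" where
  "simple_graph G \<longleftrightarrow> finite (verts G) \<and> (\<forall>e\<in>edges G. e \<subseteq> verts G \<and> card e = 2)"

definition subgraph :: "'a graph \<Rightarrow> 'a graph \<Rightarrow> bool" where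
  "subgraph F G \<longleftrightarrow> simple_graph F \<and> verts F \<subseteq> verts G \<and> edges F \<subseteq> edges G"

definition graph_iso :: "'a graph \<Rightarrow> 'b graph \<Rightarrow> bool" where
  "graph_iso F H \<longleftrightarrow> (\<exists>f. bij_betw f (verts F) (verts H) \<and>
     (\<forall>u\<in>verts F. \<forall>v\<in>verts F. {u, v} \<in> edges F \<longleftrightarrow> {f u, f v} \<in> edges H))"

definition path_graph :: "nat \<Rightarrow> nat graph" where
  "path_graph n = ({..<n}, {{i, i + 1} |i. i + 1 < n})"

(* The usual cycle for n >= 3; for smaller n this is not a simple cycle. *)
definition cycle_graph :: "nat \<Rightarrow> nat graph" where
  "cycle_graph n = ({..<n}, {{i, (i + 1) mod n} |i. i < n})"

definition disjoint_union :: "'a graph \<Rightarrow> 'b graph \<Rightarrow> ('a + 'b) graph" where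
  "disjoint_union G H =
     (verts G <+> verts H, (\<lambda>e. Inl ` e) ` edges G \<union> (\<lambda>e. Inr ` e) ` edges H)"

definition disjoint_Union :: "'i set \<Rightarrow> ('i \<Rightarrow> 'a graph) \<Rightarrow> ('i \<times> 'a) graph" where
  "disjoint_Union I G =
     (SIGMA i:I. verts (G i), \<Union>i\<in>I. (\<lambda>e. Pair i ` e) ` edges (G i))"

definition complete_bipartite :: "nat \<Rightarrow> nat \<Rightarrow> (nat + nat) graph" where
  "complete_bipartite a b =
     ({..<a} <+> {..<b}, {{Inl u, Inr v} |u v. u < a \<and> v < b})"

definition exact_edge_coloring :: "nat \<Rightarrow> 'a graph \<Rightarrow> ('a set \<Rightarrow> nat) \<Rightarrow> bool" where
  "exact_edge_coloring k G c \<longleftrightarrow> c ` edges G = {1..k}"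

definition copy_in :: "'a graph \<Rightarrow> 'b graph \<Rightarrow> 'a graph \<Rightarrow> bool" where
  "copy_in F H G \<longleftrightarrow> subgraph F G \<and> graph_iso F H"

definition rainbow :: "('a set \<Rightarrow> nat) \<Rightarrow> 'a graph \<Rightarrow> bool" where
  "rainbow c F \<longleftrightarrow> inj_on c (edges F)"

definition monochromatic :: "('a set \<Rightarrow> nat) \<Rightarrow> 'a graph \<Rightarrow> bool" where
  "monochromatic c F \<longleftrightarrow> (\<forall>e\<in>edges F. \<forall>e'\<in>edges F. c e = c e')"

definition bgr_admissible :: "nat \<Rightarrow> 'a graph \<Rightarrow> 'b graph \<Rightarrow> nat \<Rightarrow> bool" where
  "bgr_admissible k G H n \<longleftrightarrow> k \<le> n ^ 2 \<and>
     (\<forall>N\<ge>n. \<forall>c. exact_edge_coloring k (complete_bipartite N N) c \<longrightarrow>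
        (\<exists>F. copy_in F G (complete_bipartite N N) \<and> rainbow c F) \<or>
        (\<exists>F. copy_in F H (complete_bipartite N N) \<and> monochromatic c F))"

(* The value is infinity if no n is admissible, so bgr k G H = enat n says that n is
   admissible and that no smaller number is. *)
definition bgr :: "nat \<Rightarrow> 'a graph \<Rightarrow> 'b graph \<Rightarrow> enat" where
  "bgr k G H = Inf (enat ` {n. bgr_admissible k G H n})"

end

theory Submission
  imports Defs
begin

text \<open>
  Write \<open>t\<close> for the sum of all \<open>\<lfloor>l\<^sub>i/2\<rfloor>\<close> and \<open>m\<^sub>j\<close>, and \<open>q = t + r\<close>, so that the hypothesis
  on the number of colours is \<open>k \<ge> q + 2\<close> and the claimed value is \<open>k (t - 1) + 1\<close>.
  The number \<open>t\<close> is both the matching number and the vertex cover number of the target graph.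

  Lower bound. In \<open>K\<^bsub>n,n\<^esub>\<close> with \<open>n = k (t - 1)\<close>, cut the left side into \<open>k\<close> blocks of
  \<open>t - 1\<close> vertices and give every edge the number of the block of its left end. A path with five
  vertices has a left vertex with two path edges, so it is not rainbow. Each colour class is covered
  by \<open>t - 1\<close> vertices, whereas the target contains a matching with \<open>t\<close> edges.

  Upper bound. A colouring of a complete bipartite graph is a matrix \<open>d\<close> of colours, with the left
  vertices as rows and the right vertices as columns. If both sides have at least five vertices, at
  least four colours occur and there is no rainbow \<open>P\<^sub>5\<close>, then
  (\<open>no_rainbow_P5_trichotomy\<close>), up to exchanging the sides, one of the following holds:
  \<^item> There is one colour such that each column is either constant in that colour or equal to a
    fixed column. If at least \<open>t\<close> columns are constant, they give a monochromatic
    biclique; otherwise the remaining columns are so many that it suffices to find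
    \<open>t\<close> rows of the same colour there, which exist by the pigeonhole principle. Either way there is
    a monochromatic biclique with sides \<open>t\<close> and \<open>q\<close>, and it contains the target with its
    smaller side placed on the \<open>t\<close> vertices.
  \<^item> There is a dominating colour \<open>z\<close> such that every vertex sees at most one other colour. Edges of
    pairwise distinct colours other than \<open>z\<close> are then disjoint, and any two of their ends on
    opposite sides that come from different edges are joined in colour \<open>z\<close>. So colour \<open>z\<close>
    contains a crown, a complete bipartite graph minus a perfect matching, with \<open>k - 1 > q\<close>
    vertices on each side. When \<open>q \<ge> 3\<close>, a shift by two places embeds the target in it
    (\<open>monochromatic_copy_in_crown\<close>). The case \<open>q = 2\<close> is that of a four-cycle, which the
    crown with three vertices on each side does not contain; there an additional
    row supplies it (\<open>dominated_coloring_four_cycle\<close>).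
\<close>

section \<open>Colourings of complete bipartite graphs without rainbow \<open>P\<^sub>5\<close>\<close>

text \<open>
  Here \<open>f\<close> and \<open>g\<close> are two columns of the colour matrix, and the hypothesis \<open>forced\<close> says that the
  path through the rows \<open>y, x, p\<close> that uses column \<open>f\<close> between \<open>y\<close> and \<open>x\<close> and column \<open>g\<close> between
  \<open>x\<close> and \<open>p\<close> is not rainbow. A row where the columns differ thus
  restricts every other entry of \<open>g\<close>, and two different choices of \<open>y\<close> nearly determine it. On four rows
  a column \<open>g\<close> that is not constant can survive: any two columns of the multiplication table of Klein's
  four-group satisfy all the restrictions. A fifth row excludes this.
\<close>


lemma column_forcing:
  fixes f g :: "'a \<Rightarrow> 'c"
  assumes forced: "\<And>x y p. \<lbrakk>x \<in> U; y \<in> U; p \<in> U; x \<noteq> y; x \<noteq> p; y \<noteq> p; f x \<noteq> g x; f y \<noteq> f x; f y \<noteq> g x\<rbrakk>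
      \<Longrightarrow> g p = f x \<or> g p = g x \<or> g p = f y"
    and card: "5 \<le> card U"
    and u: "u \<in> U" "f u \<noteq> g u"
    and a: "a \<in> U" "f a \<noteq> f u" "f a \<noteq> g u"
    and b: "b \<in> U" "f b \<noteq> f u" "f b \<noteq> g u"
    and ab: "f a \<noteq> f b"
    and p: "p \<in> U"
  shows "g p = g u"
proof -
  have key: "g x = g u"
    if x: "x \<in> U" "f x \<noteq> f u" "f x \<noteq> g u" and y: "y \<in> U" "f y \<noteq> f u" "f y \<noteq> g u"
      and xy: "f x \<noteq> f y" for x y
  proof (rule ccontr)
    assume neq: "g x \<noteq> g u"
    have d: "u \<noteq> x" "u \<noteq> y" "x \<noteq> y" using x y xy by auto
    have "g x = f u \<or> g x = g u \<or> g x = f y"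
      by (rule forced) (use u x y xy d in auto)
    \<comment> \<open>If \<open>g x = f u\<close>, then the row \<open>x\<close> restricts \<open>g u\<close> to values that it does not have.\<close>
    moreover have "g x \<noteq> f u"
    proof
      assume e: "g x = f u"
      have "g u = f x \<or> g u = g x \<or> g u = f y"
        by (rule forced) (use u x y xy d e in auto)
      then show False using u x y e by auto
    qed
    ultimately have gx: "g x = f y" using neq by blast
    have "finite U" using card by (metis card.infinite not_numeral_le_zero)
    then have "card (U - {u, x, y}) \<ge> 2"
      using card u x y d by (simp add: card_Diff_subset)
    then obtain T where T: "T \<subseteq> U - {u, x, y}" "card T = 2"
      by (meson obtain_subset_with_card_n)
    then obtain q q' where q: "q \<in> U" "q' \<in> U" "q \<noteq> q'" "q \<notin> {u, x, y}" "q' \<notin> {u, x, y}"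
      by (auto simp: card_2_iff)
    \<comment> \<open>The rows \<open>u\<close> and \<open>x\<close> now carry a Klein pattern. It forces the same entries in each further
      row, and two such rows contradict each other.\<close>
    have out: "g w = f u \<and> f w = g u" if w: "w \<in> U" "w \<notin> {u, x, y}" for w
    proof -
      have "g w = f u \<or> g w = g u \<or> g w = f x"
        by (rule forced) (use u x y xy d w in auto)
      moreover have "g w = f u \<or> g w = g u \<or> g w = f y"
        by (rule forced) (use u x y xy d w in auto)
      moreover have "g w = f x \<or> g w = g x \<or> g w = f u"
        by (rule forced) (use u x y xy d w gx in auto)
      ultimately have gw: "g w = f u" using gx x y xy by auto
      have fw: "f w \<noteq> f u"
      proof
        assume e: "f w = f u"
        have "g u = f x \<or> g u = g x \<or> g u = f w"
          by (rule forced) (use u x y xy d w gx e in auto)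
        then show False using gx x y u e by auto
      qed
      have "f w = g u"
      proof (rule ccontr)
        assume n: "f w \<noteq> g u"
        have "\<exists>h \<in> {x, y}. f h \<noteq> f w" using xy by auto
        then obtain h where h: "h \<in> {x, y}" "f h \<noteq> f w" by blast
        have "g u = f w \<or> g u = g w \<or> g u = f h"
          by (rule forced) (use u x y xy d w gw fw h in auto)
        then show False using n gw u h x y by auto
      qed
      then show ?thesis using gw by simp
    qed
    have "g q' = f x \<or> g q' = g x \<or> g q' = f q"
      by (rule forced) (use out q gx u x y xy d in auto)
    then show False using out[of q] out[of q'] q gx u x y by auto
  qed
  have ga: "g a = g u" "g b = g u"
    using key[OF a b ab] key[OF b a] ab by auto
  show ?thesis
  proof (cases "p = u \<or> p = a \<or> p = b")
    case True then show ?thesis using ga by auto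
  next
    case False
    have "g p = f u \<or> g p = g u \<or> g p = f a" "g p = f u \<or> g p = g u \<or> g p = f b"
      by (rule forced; use False u a b p in auto)+
    moreover have "g p = f a \<or> g p = g a \<or> g p = f b"
      by (rule forced) (use False u a b ab p ga in auto)
    ultimately show ?thesis using ga a b ab by auto
  qed
qed

text \<open>
  The five-vertex paths with both ends in \<open>U\<close>. Those with both ends in \<open>V\<close> are the subject of the
  same predicate for the transposed matrix.
\<close>
definition no_rainbow_P5 :: "'a set \<Rightarrow> 'b set \<Rightarrow> ('a \<Rightarrow> 'b \<Rightarrow> 'c) \<Rightarrow> bool" where
  "no_rainbow_P5 U V d \<longleftrightarrow>
     (\<forall>u\<^sub>1\<in>U. \<forall>u\<^sub>2\<in>U. \<forall>u\<^sub>3\<in>U. \<forall>v\<^sub>1\<in>V. \<forall>v\<^sub>2\<in>V. distinct [u\<^sub>1, u\<^sub>2, u\<^sub>3] \<longrightarrow> v\<^sub>1 \<noteq> v\<^sub>2 \<longrightarrow>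
        \<not> distinct [d u\<^sub>1 v\<^sub>1, d u\<^sub>2 v\<^sub>1, d u\<^sub>2 v\<^sub>2, d u\<^sub>3 v\<^sub>2])"

lemma no_rainbow_P5D:
  assumes "no_rainbow_P5 U V d" "distinct [d u\<^sub>1 v\<^sub>1, d u\<^sub>2 v\<^sub>1, d u\<^sub>2 v\<^sub>2, d u\<^sub>3 v\<^sub>2]"
    "u\<^sub>1 \<in> U" "u\<^sub>2 \<in> U" "u\<^sub>3 \<in> U" "v\<^sub>1 \<in> V" "v\<^sub>2 \<in> V" "distinct [u\<^sub>1, u\<^sub>2, u\<^sub>3]" "v\<^sub>1 \<noteq> v\<^sub>2"
  shows False
  using assms unfolding no_rainbow_P5_def by blast

text \<open>
  In a colouring by rows, every edge has the colour \<open>f u\<close> of its row. Here some columns may deviate,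
  all of them in the same way.
\<close>
definition almost_row_coloring :: "'a set \<Rightarrow> 'b set \<Rightarrow> ('a \<Rightarrow> 'b \<Rightarrow> 'c) \<Rightarrow> bool" where
  "almost_row_coloring U V d \<longleftrightarrow>
     (\<exists>f z. (\<forall>v\<in>V. (\<forall>u\<in>U. d u v = f u) \<or> (\<forall>u\<in>U. d u v = z)))"

definition dominated_coloring :: "'a set \<Rightarrow> 'b set \<Rightarrow> ('a \<Rightarrow> 'b \<Rightarrow> 'c) \<Rightarrow> 'c \<Rightarrow> bool" where
  "dominated_coloring U V d z \<longleftrightarrow>
     (\<forall>u\<in>U. \<forall>v\<in>V. \<forall>v'\<in>V. d u v \<noteq> z \<longrightarrow> d u v' \<noteq> z \<longrightarrow> d u v = d u v') \<and>
     (\<forall>v\<in>V. \<forall>u\<in>U. \<forall>u'\<in>U. d u v \<noteq> z \<longrightarrow> d u' v \<noteq> z \<longrightarrow> d u v = d u' v)"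

text \<open>
  Take a column \<open>f\<close> with at least three colours. By \<open>column_forcing\<close>, another column that differs
  from \<open>f\<close> in some row is constant as soon as \<open>f\<close> has two colours besides the two entries in
  that row. This is always so if \<open>f\<close> has four colours. If \<open>f\<close> has
  only three, then a fourth colour in some other column makes that column constant, and a path that
  starts in the constant column settles the others. Two constant columns of different colours would be
  the ends of a rainbow path through column \<open>f\<close>.
\<close>
lemma almost_row_coloring_if_three_colors:
  fixes d :: "'a \<Rightarrow> 'b \<Rightarrow> 'c"
  assumes UV: "no_rainbow_P5 U V d" and VU: "no_rainbow_P5 V U (\<lambda>v u. d u v)"
    and card: "5 \<le> card U"
    and v: "v \<in> V" and three: "3 \<le> card ((\<lambda>u. d u v) ` U)"
    and four: "4 \<le> card ((\<lambda>(u, v). d u v) ` (U \<times> V))"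
  shows "almost_row_coloring U V d"
proof -
  define f where "f u = d u v" for u
  have finU: "finite U" using card by (metis card.infinite not_numeral_le_zero)
  have other: "\<exists>u\<in>U. f u \<notin> C" if "card C < card (f ` U)" "finite C" for C
    using that by (metis card_mono image_subset_iff not_le)
  have three': "3 \<le> card (f ` U)" using three by (simp add: f_def)
  have two: "card {x, y} < 3" for x y :: 'c by (simp add: card_insert_if)
  have const: "\<forall>p\<in>U. d p v' = d u v'"
    if v': "v' \<in> V" "v' \<noteq> v" and u: "u \<in> U" "f u \<noteq> d u v'"
      and big: "card {f u, d u v'} + 1 < card (f ` U) \<or> d u v' \<notin> f ` U" for u v'
  proof -
    have "\<exists>a b. a \<in> U \<and> b \<in> U \<and> f a \<notin> {f u, d u v'} \<and> f b \<notin> {f u, d u v'} \<and> f a \<noteq> f b"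
    proof -
      obtain a where a: "a \<in> U" "f a \<notin> {f u, d u v'}"
        using other[of "{f u, d u v'}"] two[of "f u" "d u v'"] three' by auto
      have "\<exists>b\<in>U. f b \<notin> {f u, d u v', f a}"
      proof (cases "d u v' \<in> f ` U")
        case True
        then have "card {f u, d u v', f a} < card (f ` U)"
          using big a by (simp add: card_insert_if split: if_splits)
        then show ?thesis using other by blast
      next
        case False
        obtain b where "b \<in> U" "f b \<notin> {f u, f a}"
          using other[of "{f u, f a}"] two[of "f u" "f a"] three' by auto
        moreover from this have "f b \<noteq> d u v'" using False by (metis image_eqI)
        ultimately show ?thesis by blast
      qed
      then show ?thesis using a by auto
    qed
    then obtain a b where ab: "a \<in> U" "b \<in> U" "f a \<notin> {f u, d u v'}" "f b \<notin> {f u, d u v'}" "f a \<noteq> f b"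
      by blast
    have forced: "d p v' = f x \<or> d p v' = d x v' \<or> d p v' = f y"
      if "x \<in> U" "y \<in> U" "p \<in> U" "x \<noteq> y" "x \<noteq> p" "y \<noteq> p" "f x \<noteq> d x v'" "f y \<noteq> f x" "f y \<noteq> d x v'"
      for x y p
    proof (rule ccontr)
      assume "\<not> ?thesis"
      then have "distinct [d y v, d x v, d x v', d p v']" using that unfolding f_def by force
      then show False by (rule no_rainbow_P5D[OF UV]) (use that v v' in auto)
    qed
    show ?thesis
    proof
      fix p assume p: "p \<in> U"
      show "d p v' = d u v'"
        by (rule column_forcing[where f = f and g = "\<lambda>p. d p v'" and U = U and a = a and b = b and u = u,
              OF forced card]) (use u ab p in simp_all)
    qed
  qed
  have unique: "x = y"
    if "v\<^sub>1 \<in> V" "v\<^sub>2 \<in> V" "v\<^sub>1 \<noteq> v" "v\<^sub>2 \<noteq> v" and c: "\<forall>p\<in>U. d p v\<^sub>1 = x" "\<forall>p\<in>U. d p v\<^sub>2 = y"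
      and ab: "a \<in> U" "b \<in> U" "f a \<notin> {x, y}" "f b \<notin> {x, y}" "f a \<noteq> f b" for v\<^sub>1 v\<^sub>2 x y a b
  proof (rule ccontr)
    assume "x \<noteq> y"
    moreover from this have "v\<^sub>1 \<noteq> v\<^sub>2" using c ab by auto
    ultimately show False
      using no_rainbow_P5D[OF VU, of a v\<^sub>1 v b v\<^sub>2] that v by (auto simp: f_def)
  qed
  show ?thesis
  proof (cases "4 \<le> card (f ` U)")
    case True
    have triv: "(\<forall>u\<in>U. d u w = f u) \<or> (\<exists>x. \<forall>u\<in>U. d u w = x)" if "w \<in> V" for w
    proof (cases "w = v \<or> (\<forall>u\<in>U. d u w = f u)")
      case False
      then obtain u where "u \<in> U" "f u \<noteq> d u w" "w \<noteq> v" by metis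
      moreover have "card {f u, d u w} + 1 < card (f ` U)"
        using two[of "f u" "d u w"] True by linarith
      ultimately show ?thesis using const[of w u] that by blast
    qed (auto simp: f_def)
    have same: "x = y"
      if "v\<^sub>1 \<in> V" "v\<^sub>2 \<in> V" "\<not> (\<forall>u\<in>U. d u v\<^sub>1 = f u)" "\<not> (\<forall>u\<in>U. d u v\<^sub>2 = f u)"
        "\<forall>p\<in>U. d p v\<^sub>1 = x" "\<forall>p\<in>U. d p v\<^sub>2 = y" for v\<^sub>1 v\<^sub>2 x y
    proof -
      obtain a where a: "a \<in> U" "f a \<notin> {x, y}"
        using other[of "{x, y}"] two[of x y] True by auto
      have "card {x, y, f a} < 4" by (simp add: card_insert_if)
      then obtain b where b: "b \<in> U" "f b \<notin> {x, y, f a}"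
        using other[of "{x, y, f a}"] True by auto
      have "v\<^sub>1 \<noteq> v" "v\<^sub>2 \<noteq> v" using that(3,4) by (auto simp only: f_def)
      then show ?thesis
        by (rule unique[OF that(1,2) _ _ that(5,6) a(1) b(1)]) (use a b in auto)
    qed
    have "\<exists>z. \<forall>w\<in>V. (\<forall>u\<in>U. d u w = f u) \<or> (\<forall>u\<in>U. d u w = z)"
    proof (cases "\<forall>w\<in>V. \<forall>u\<in>U. d u w = f u")
      case False
      then obtain v\<^sub>1 where v1: "v\<^sub>1 \<in> V" "\<not> (\<forall>u\<in>U. d u v\<^sub>1 = f u)" by blast
      then obtain z where z: "\<forall>p\<in>U. d p v\<^sub>1 = z" using triv by blast
      have "(\<forall>u\<in>U. d u w = f u) \<or> (\<forall>u\<in>U. d u w = z)" if w: "w \<in> V" for w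
        using triv[OF w] same[OF v1(1) w v1(2) _ z] by blast
      then show ?thesis by blast
    qed blast
    then show ?thesis unfolding almost_row_coloring_def by blast
  next
    case False
    obtain u\<^sub>4 v\<^sub>4 where u4: "u\<^sub>4 \<in> U" "v\<^sub>4 \<in> V" "d u\<^sub>4 v\<^sub>4 \<notin> f ` U"
    proof -
      have "\<not> (\<lambda>(u, v). d u v) ` (U \<times> V) \<subseteq> f ` U"
        using four False finU by (meson card_mono finite_imageI le_trans)
      then show ?thesis using that by auto
    qed
    define z where "z = d u\<^sub>4 v\<^sub>4"
    have v4: "v\<^sub>4 \<noteq> v" using u4 by (auto simp: f_def)
    have fu4: "f u\<^sub>4 \<noteq> d u\<^sub>4 v\<^sub>4" using u4 by (metis image_eqI)
    have z: "\<forall>p\<in>U. d p v\<^sub>4 = z"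
      using const[OF u4(2) v4 u4(1) fu4] u4(3) unfolding z_def by blast
    have zf: "z \<notin> f ` U" using u4 by (simp add: z_def)
    have "(\<forall>u\<in>U. d u w = f u) \<or> (\<forall>u\<in>U. d u w = z)" if w: "w \<in> V" for w
    proof (cases "w = v \<or> (\<forall>u\<in>U. d u w = f u)")
      case False
      then obtain u where u: "u \<in> U" "f u \<noteq> d u w" "w \<noteq> v" by metis
      obtain a where a: "a \<in> U" "f a \<notin> {f u, d u w}"
        using other[of "{f u, d u w}"] two[of "f u" "d u w"] three' by auto
      have duw: "d u w = z"
      proof (rule ccontr)
        assume n: "d u w \<noteq> z"
        then have "w \<noteq> v\<^sub>4" using z u by auto
        then show False
          using no_rainbow_P5D[OF VU, of a v\<^sub>4 v u w] n z zf u a v4 u4 v w by (auto simp: f_def)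
      qed
      have "d u w \<notin> f ` U" using zf duw by simp
      then have "\<forall>p\<in>U. d p w = d u w" using const[OF w u(3) u(1,2)] by blast
      then show ?thesis unfolding duw by blast
    qed (auto simp: f_def)
    then show ?thesis unfolding almost_row_coloring_def by blast
  qed
qed


text \<open>
  First there is a rainbow path \<open>a, b, c, e\<close> with three edges, and then an edge \<open>x y\<close> of a fourth
  colour. Since every vertex sees at most two colours and no rainbow path has four edges, \<open>x y\<close> is
  disjoint from the path, and all six vertices see the middle colour \<open>d c b\<close>.
  The ends of each of the edges \<open>a b\<close>, \<open>c e\<close> and \<open>x y\<close> see just the middle colour and that of the edge.
  Every vertex is joined to one end of each of the three edges, so it would see three colours if it did
  not see the middle one.
\<close>
lemma dominated_coloring_if_two_colors:
  fixes d :: "'a \<Rightarrow> 'b \<Rightarrow> 'c"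
  assumes UV: "no_rainbow_P5 U V d" and VU: "no_rainbow_P5 V U (\<lambda>v u. d u v)"
    and card: "3 \<le> card U"
    and rows: "\<And>u v\<^sub>1 v\<^sub>2 v\<^sub>3. u \<in> U \<Longrightarrow> {v\<^sub>1, v\<^sub>2, v\<^sub>3} \<subseteq> V \<Longrightarrow> \<not> distinct [d u v\<^sub>1, d u v\<^sub>2, d u v\<^sub>3]"
    and cols: "\<And>v u\<^sub>1 u\<^sub>2 u\<^sub>3. v \<in> V \<Longrightarrow> {u\<^sub>1, u\<^sub>2, u\<^sub>3} \<subseteq> U \<Longrightarrow> \<not> distinct [d u\<^sub>1 v, d u\<^sub>2 v, d u\<^sub>3 v]"
    and four: "4 \<le> card ((\<lambda>(u, v). d u v) ` (U \<times> V))"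
  shows "\<exists>z. dominated_coloring U V d z"
proof -
  have new: "\<exists>u\<in>U. \<exists>v\<in>V. d u v \<notin> C" if "card C < 4" "finite C" for C
  proof -
    have "\<not> (\<lambda>(u, v). d u v) ` (U \<times> V) \<subseteq> C"
      using that four by (meson card_mono le_trans not_le)
    then show ?thesis by auto
  qed
  \<comment> \<open>If all columns were constant, all colours would occur in a single row.\<close>
  have "\<exists>v\<in>V. \<exists>u\<in>U. \<exists>u'\<in>U. d u v \<noteq> d u' v"
  proof (rule ccontr)
    assume const: "\<not> ?thesis"
    have new_in_row: "\<exists>v\<in>V. d u v \<notin> C" if "card C < 4" "finite C" "u \<in> U" for C u
      using new[OF that(1,2)] const that(3) by metis
    obtain u v where uv: "u \<in> U" "v \<in> V" using new[of "{}"] by auto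
    obtain v' where v': "v' \<in> V" "d u v' \<noteq> d u v" using new_in_row[of "{d u v}" u] uv by auto
    have "card {d u v, d u v'} < 4" by (simp add: card_insert_if)
    then obtain v'' where "v'' \<in> V" "d u v'' \<noteq> d u v" "d u v'' \<noteq> d u v'"
      using new_in_row[of "{d u v, d u v'}" u] uv by auto
    then show False using rows[of u v v' v''] uv v' by auto
  qed
  then obtain b u u' where b: "b \<in> V" "u \<in> U" "u' \<in> U" "d u b \<noteq> d u' b" by blast
  have "card {d u b, d u' b} < 4" by (simp add: card_insert_if)
  then obtain c e where c: "c \<in> U" "e \<in> V" "d c e \<notin> {d u b, d u' b}"
    using new[of "{d u b, d u' b}"] by auto
  have "d c b = d u b \<or> d c b = d u' b" using cols[of b u u' c] b c by auto
  then obtain a where "a \<in> U" "d a b \<noteq> d c b" "d a b \<in> {d u b, d u' b}"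
    using b by (metis insertI1 insertI2)
  moreover from this have "a \<noteq> c" "d c b \<noteq> d c e" using c \<open>d c b = d u b \<or> d c b = d u' b\<close> by auto
  ultimately have a: "a \<in> U" "a \<noteq> c" "distinct [d a b, d c b, d c e]" using c by auto
  have be: "b \<noteq> e" using a by auto
  have "card {d a b, d c b, d c e} < 4" by (simp add: card_insert_if)
  then obtain x y where xy: "x \<in> U" "y \<in> V" "d x y \<notin> {d a b, d c b, d c e}"
    using new[of "{d a b, d c b, d c e}"] by auto
  have xc: "x \<noteq> c" using rows[of c b e y] a b c xy by auto
  have yb: "y \<noteq> b" using cols[of b a c x] a b c xy by auto
  \<comment> \<open>Otherwise \<open>x = a\<close> and the edge closes the path to a rainbow four-cycle. From any third row \<open>p\<close>
    a rainbow path enters the cycle at \<open>b\<close> and runs around it in one of the two directions.\<close>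
  have ye: "y \<noteq> e"
  proof
    assume ye: "y = e"
    have xa: "x = a" by (rule ccontr) (use no_rainbow_P5D[OF UV, of a b c e x] a b c be xy xc ye in auto)
    have "card {a, c} < 3" by (simp add: card_insert_if)
    then have "\<not> U \<subseteq> {a, c}" using card card_mono[of "{a, c}" U] by auto
    then obtain p where p: "p \<in> U" "p \<noteq> a" "p \<noteq> c" by blast
    have "d p b = d a b \<or> d p b = d c b" using cols[of b a c p] a b c p by auto
    then show False
      using no_rainbow_P5D[OF UV, of p b c e a] no_rainbow_P5D[OF UV, of p b a e c]
        a b c p xy xa ye be by auto
  qed
  have xa: "x \<noteq> a" using no_rainbow_P5D[OF VU, of a y b c e] a b c be xy ye yb by auto
  have cy: "d c y = d c b \<or> d c y = d c e" using rows[of c b e y] a b c xy by auto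
  have ay: "d a y = d c y"
    by (rule ccontr) (use cols[of y a c x] cy no_rainbow_P5D[OF VU, of a y b c e] a b c xy be ye yb in auto)
  have cy: "d c y = d c b"
    by (rule ccontr) (use cy ay no_rainbow_P5D[OF UV, of x y a b c] a b c xy xa xc yb in auto)
  have xb: "d x b = d a b \<or> d x b = d c b" using cols[of b a c x] a b c xy by auto
  have xe: "d x e = d x b"
    by (rule ccontr) (use rows[of x b e y] xb no_rainbow_P5D[OF UV, of a b c e x] a b c xy be xa xc in auto)
  have xb: "d x b = d c b"
    by (rule ccontr) (use xb xe no_rainbow_P5D[OF VU, of x y e c b] a b c xy xc ye yb be in auto)
  let ?z = "d c b"
  have row: "\<exists>v\<in>V. d p v = ?z" if p: "p \<in> U" for p
  proof -
    have "d p b \<in> {d a b, ?z}" "d p e \<in> {d c e, ?z}" "d p y \<in> {d x y, ?z}"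
      using cols[of b a c p] cols[of e c x p] cols[of y x c p] a b c xy p cy xb xe by auto
    then show ?thesis using rows[of p b e y] p a b c xy by auto
  qed
  have col: "\<exists>u\<in>U. d u q = ?z" if q: "q \<in> V" for q
  proof -
    have "d a q \<in> {d a b, ?z}" "d c q \<in> {d c e, ?z}" "d x q \<in> {d x y, ?z}"
      using rows[of a b y q] rows[of c b e q] rows[of x y b q] a b c xy q cy ay xb xe by auto
    then show ?thesis using cols[of q a c x] q a b c xy by auto
  qed
  have "dominated_coloring U V d ?z"
    unfolding dominated_coloring_def
  proof (intro conjI ballI impI)
    fix u v v' assume h: "u \<in> U" "v \<in> V" "v' \<in> V" "d u v \<noteq> ?z" "d u v' \<noteq> ?z"
    obtain w where "w \<in> V" "d u w = ?z" using row h by blast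
    then show "d u v = d u v'" using rows[of u v v' w] h by auto
  next
    fix v u u' assume h: "v \<in> V" "u \<in> U" "u' \<in> U" "d u v \<noteq> ?z" "d u' v \<noteq> ?z"
    obtain w where "w \<in> U" "d w v = ?z" using col h by blast
    then show "d u v = d u' v" using cols[of v u u' w] h by auto
  qed
  then show ?thesis by blast
qed

lemma card_ge_3_if_distinct:
  assumes "finite S" "{x, y, z} \<subseteq> S" "distinct [x, y, z]"
  shows "3 \<le> card S"
  using card_mono[OF assms(1,2)] assms(3) by simp

theorem no_rainbow_P5_trichotomy:
  fixes d :: "'a \<Rightarrow> 'b \<Rightarrow> 'c"
  assumes UV: "no_rainbow_P5 U V d" and VU: "no_rainbow_P5 V U (\<lambda>v u. d u v)"
    and cU: "5 \<le> card U" and cV: "5 \<le> card V"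
    and four: "4 \<le> card ((\<lambda>(u, v). d u v) ` (U \<times> V))"
  shows "almost_row_coloring U V d \<or> almost_row_coloring V U (\<lambda>v u. d u v)
    \<or> (\<exists>z. dominated_coloring U V d z)"
proof (cases "(\<exists>v\<in>V. 3 \<le> card ((\<lambda>u. d u v) ` U)) \<or> (\<exists>u\<in>U. 3 \<le> card ((\<lambda>v. d u v) ` V))")
  case True
  have swap: "(\<lambda>(v, u). d u v) ` (V \<times> U) = (\<lambda>(u, v). d u v) ` (U \<times> V)" by force
  from True show ?thesis
  proof (elim disjE bexE)
    fix v assume "v \<in> V" "3 \<le> card ((\<lambda>u. d u v) ` U)"
    then show ?thesis using almost_row_coloring_if_three_colors[OF UV VU cU _ _ four] by blast
  next
    fix u assume "u \<in> U" "3 \<le> card ((\<lambda>v. d u v) ` V)"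
    then show ?thesis
      using almost_row_coloring_if_three_colors[OF VU UV cV] four unfolding swap by blast
  qed
next
  case False
  have fin: "finite U" "finite V" using cU cV by (metis card.infinite not_numeral_le_zero)+
  have "\<not> distinct [d u v\<^sub>1, d u v\<^sub>2, d u v\<^sub>3]" if "u \<in> U" "{v\<^sub>1, v\<^sub>2, v\<^sub>3} \<subseteq> V" for u v\<^sub>1 v\<^sub>2 v\<^sub>3
    using that False card_ge_3_if_distinct[of "(\<lambda>v. d u v) ` V" "d u v\<^sub>1" "d u v\<^sub>2" "d u v\<^sub>3"] fin
    by blast
  moreover have "\<not> distinct [d u\<^sub>1 v, d u\<^sub>2 v, d u\<^sub>3 v]" if "v \<in> V" "{u\<^sub>1, u\<^sub>2, u\<^sub>3} \<subseteq> U" for v u\<^sub>1 u\<^sub>2 u\<^sub>3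
    using that False card_ge_3_if_distinct[of "(\<lambda>u. d u v) ` U" "d u\<^sub>1 v" "d u\<^sub>2 v" "d u\<^sub>3 v"] fin
    by blast
  ultimately show ?thesis
    using dominated_coloring_if_two_colors[OF UV VU _ _ _ four] cU by auto
qed


section \<open>Copies as images of injective maps\<close>

lemma copy_in_image:
  fixes H :: "'a graph" and G :: "'b graph"
  assumes H: "simple_graph H" and inj: "inj_on \<phi> (verts H)"
    and verts: "\<phi> ` verts H \<subseteq> verts G" and edges: "\<And>e. e \<in> edges H \<Longrightarrow> \<phi> ` e \<in> edges G"
  shows "copy_in (\<phi> ` verts H, (\<lambda>e. \<phi> ` e) ` edges H) H G"
proof -
  have eH: "e \<subseteq> verts H" "card e = 2" if "e \<in> edges H" for e
    using H that by (auto simp: simple_graph_def)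
  have "card (\<phi> ` e) = 2" if "e \<in> edges H" for e
    using eH[OF that] inj by (metis card_image inj_on_subset)
  then have "simple_graph (\<phi> ` verts H, (\<lambda>e. \<phi> ` e) ` edges H)"
    using H eH by (auto simp: simple_graph_def)
  then have sub: "subgraph (\<phi> ` verts H, (\<lambda>e. \<phi> ` e) ` edges H) G"
    using verts edges by (auto simp: subgraph_def)
  let ?f = "inv_into (verts H) \<phi>"
  have "bij_betw ?f (\<phi> ` verts H) (verts H)"
    using inj by (simp add: bij_betw_inv_into inj_on_imp_bij_betw)
  moreover have "{\<phi> a, \<phi> b} \<in> (\<lambda>e. \<phi> ` e) ` edges H \<longleftrightarrow> {?f (\<phi> a), ?f (\<phi> b)} \<in> edges H"
    if ab: "a \<in> verts H" "b \<in> verts H" for a b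
  proof -
    have "\<phi> ` {a, b} \<in> (\<lambda>e. \<phi> ` e) ` edges H \<longleftrightarrow> {a, b} \<in> edges H"
    proof
      assume "\<phi> ` {a, b} \<in> (\<lambda>e. \<phi> ` e) ` edges H"
      then obtain e where e: "e \<in> edges H" "\<phi> ` {a, b} = \<phi> ` e" by blast
      then have "{a, b} = e"
        using inj_on_image_eq_iff[OF inj, of "{a, b}" e] ab eH[of e] by auto
      then show "{a, b} \<in> edges H" using e by simp
    qed blast
    then show ?thesis using ab inj by (simp add: inv_into_f_f)
  qed
  ultimately have "graph_iso (\<phi> ` verts H, (\<lambda>e. \<phi> ` e) ` edges H) H"
    unfolding graph_iso_def by (intro exI[of _ ?f]) auto
  then show ?thesis using sub by (simp add: copy_in_def)
qed

lemma copy_in_obtain_embedding: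
  fixes H :: "'a graph" and G :: "'b graph"
  assumes "copy_in F H G" and H: "simple_graph H"
  obtains \<phi> where "inj_on \<phi> (verts H)" "\<And>e. e \<in> edges H \<Longrightarrow> \<phi> ` e \<in> edges F" "edges F \<subseteq> edges G"
proof -
  obtain f where f: "bij_betw f (verts F) (verts H)"
    and e: "\<And>u v. u \<in> verts F \<Longrightarrow> v \<in> verts F \<Longrightarrow> {u, v} \<in> edges F \<longleftrightarrow> {f u, f v} \<in> edges H"
    using assms(1) unfolding copy_in_def graph_iso_def by auto
  let ?\<phi> = "inv_into (verts F) f"
  have \<phi>: "bij_betw ?\<phi> (verts H) (verts F)" using f by (rule bij_betw_inv_into)
  show ?thesis
  proof
    show "inj_on ?\<phi> (verts H)" using \<phi> by (rule bij_betw_imp_inj_on)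
    show "edges F \<subseteq> edges G" using assms(1) by (simp add: copy_in_def subgraph_def)
    fix e assume eH: "e \<in> edges H"
    then obtain a b where ab: "e = {a, b}" "a \<in> verts H" "b \<in> verts H"
      using H by (fastforce simp: simple_graph_def card_2_iff)
    then have "?\<phi> a \<in> verts F" "?\<phi> b \<in> verts F" "f (?\<phi> a) = a" "f (?\<phi> b) = b"
      using f \<phi> by (auto simp: bij_betw_def intro: inv_into_into f_inv_into_f)
    then show "?\<phi> ` e \<in> edges F" using e[of "?\<phi> a" "?\<phi> b"] eH ab by simp
  qed
qed

lemma simple_path_graph: "simple_graph (path_graph n)"
  by (auto simp: simple_graph_def path_graph_def)

lemma simple_cycle_graph: "3 \<le> n \<Longrightarrow> simple_graph (cycle_graph n)"
  by (fastforce simp: simple_graph_def cycle_graph_def card_insert_if mod_Suc)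

lemma simple_disjoint_union:
  "simple_graph G \<Longrightarrow> simple_graph H \<Longrightarrow> simple_graph (disjoint_union G H)"
  by (auto simp: simple_graph_def disjoint_union_def card_image)

lemma simple_disjoint_Union:
  assumes "finite I" "\<And>i. i \<in> I \<Longrightarrow> simple_graph (G i)"
  shows "simple_graph (disjoint_Union I G)"
  using assms by (fastforce simp: simple_graph_def disjoint_Union_def card_image inj_on_def)

section \<open>Rainbow copies of \<open>P\<^sub>5\<close>\<close>

lemma edges_path_graph_5: "edges (path_graph 5) = {{0, 1}, {1, 2}, {2, 3}, {3, 4}}"
proof -
  have "{{i, i + 1} |i. i + 1 < (5::nat)} = (\<lambda>i. {i, i + 1}) ` {..<4}" by auto
  also have "{..<4::nat} = {0, 1, 2, 3}" by auto
  finally show ?thesis by (simp add: path_graph_def eval_nat_numeral)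
qed

lemma rainbow_path_graph_5:
  assumes "distinct [p\<^sub>0, p\<^sub>1, p\<^sub>2, p\<^sub>3, p\<^sub>4]" "{p\<^sub>0, p\<^sub>1, p\<^sub>2, p\<^sub>3, p\<^sub>4} \<subseteq> verts G"
    and "{{p\<^sub>0, p\<^sub>1}, {p\<^sub>1, p\<^sub>2}, {p\<^sub>2, p\<^sub>3}, {p\<^sub>3, p\<^sub>4}} \<subseteq> edges G"
    and "distinct [c {p\<^sub>0, p\<^sub>1}, c {p\<^sub>1, p\<^sub>2}, c {p\<^sub>2, p\<^sub>3}, c {p\<^sub>3, p\<^sub>4}]"
  shows "\<exists>F. copy_in F (path_graph 5) G \<and> rainbow c F"
proof -
  let ?p = "\<lambda>i. [p\<^sub>0, p\<^sub>1, p\<^sub>2, p\<^sub>3, p\<^sub>4] ! i"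
  let ?F = "(?p ` verts (path_graph 5), (\<lambda>e. ?p ` e) ` edges (path_graph 5))"
  have v: "verts (path_graph 5) = {0, 1, 2, 3, 4}" by (auto simp: path_graph_def)
  have "inj_on ?p (verts (path_graph 5))" unfolding v using assms(1) by auto
  moreover have "?p ` verts (path_graph 5) \<subseteq> verts G" unfolding v using assms(2) by simp
  moreover have "?p ` e \<in> edges G" if "e \<in> edges (path_graph 5)" for e
    using that assms(3) unfolding edges_path_graph_5 by auto
  ultimately have "copy_in ?F (path_graph 5) G" by (intro copy_in_image simple_path_graph)
  moreover have "rainbow c ?F"
    using assms(4) by (auto simp: rainbow_def edges_path_graph_5)
  ultimately show ?thesis by blast
qed

lemma no_rainbow_P5_complete_bipartite:
  assumes "\<nexists>F. copy_in F (path_graph 5) (complete_bipartite a b) \<and> rainbow c F"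
  shows "no_rainbow_P5 {..<a} {..<b} (\<lambda>u v. c {Inl u, Inr v})"
    and "no_rainbow_P5 {..<b} {..<a} (\<lambda>v u. c {Inl u, Inr v})"
proof -
  show "no_rainbow_P5 {..<a} {..<b} (\<lambda>u v. c {Inl u, Inr v})"
    unfolding no_rainbow_P5_def
  proof (intro ballI impI notI)
    fix u1 u2 u3 v1 v2
    assume "u1 \<in> {..<a}" "u2 \<in> {..<a}" "u3 \<in> {..<a}" "v1 \<in> {..<b}" "v2 \<in> {..<b}"
      "distinct [u1, u2, u3]" "v1 \<noteq> v2"
      "distinct [c {Inl u1, Inr v1}, c {Inl u2, Inr v1}, c {Inl u2, Inr v2}, c {Inl u3, Inr v2}]"
    then show False
      using rainbow_path_graph_5[of "Inl u1" "Inr v1" "Inl u2" "Inr v2" "Inl u3" "complete_bipartite a b" c] assms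
      by (auto simp: complete_bipartite_def insert_commute)
  qed
  show "no_rainbow_P5 {..<b} {..<a} (\<lambda>v u. c {Inl u, Inr v})"
    unfolding no_rainbow_P5_def
  proof (intro ballI impI notI)
    fix u1 u2 u3 v1 v2
    assume "u1 \<in> {..<b}" "u2 \<in> {..<b}" "u3 \<in> {..<b}" "v1 \<in> {..<a}" "v2 \<in> {..<a}"
      "distinct [u1, u2, u3]" "v1 \<noteq> v2"
      "distinct [c {Inl v1, Inr u1}, c {Inl v1, Inr u2}, c {Inl v2, Inr u2}, c {Inl v2, Inr u3}]"
    then show False
      using rainbow_path_graph_5[of "Inr u1" "Inl v1" "Inr u2" "Inl v2" "Inr u3" "complete_bipartite a b" c] assms
      by (auto simp: complete_bipartite_def insert_commute)
  qed
qed

section \<open>Disjoint unions of paths and even cycles\<close>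

definition paths_and_cycles ::
  "nat \<Rightarrow> nat \<Rightarrow> (nat \<Rightarrow> nat) \<Rightarrow> (nat \<Rightarrow> nat) \<Rightarrow> (nat \<times> nat + nat \<times> nat) graph" where
  "paths_and_cycles r s l m =
     disjoint_union (disjoint_Union {1..r} (\<lambda>i. path_graph (l i)))
                    (disjoint_Union {1..s} (\<lambda>j. cycle_graph (2 * m j)))"

definition components :: "nat \<Rightarrow> nat \<Rightarrow> (nat + nat) set" where
  "components r s = {1..r} <+> {1..s}"

text \<open>
  Numbers of places reserved for the vertices at even and at odd positions of a component. A path
  gets \<open>\<lfloor>l/2\<rfloor> + 1\<close> even places for either parity of \<open>l\<close>, so the sums of the widths over all components
  are the numbers \<open>q\<close> and \<open>t\<close> of the introduction.
\<close>
definition even_width :: "(nat \<Rightarrow> nat) \<Rightarrow> (nat \<Rightarrow> nat) \<Rightarrow> nat + nat \<Rightarrow> nat" where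
  "even_width l m = case_sum (\<lambda>i. l i div 2 + 1) m"

definition odd_width :: "(nat \<Rightarrow> nat) \<Rightarrow> (nat \<Rightarrow> nat) \<Rightarrow> nat + nat \<Rightarrow> nat" where
  "odd_width l m = case_sum (\<lambda>i. l i div 2) m"

lemma finite_components: "finite (components r s)"
  by (simp add: components_def)

lemma sum_components:
  "sum f (components r s) = (\<Sum>i=1..r. f (Inl i)) + (\<Sum>j=1..s. f (Inr j))"
  by (simp add: components_def sum.Plus)

lemma simple_paths_and_cycles:
  assumes "\<And>j. 1 \<le> j \<Longrightarrow> j \<le> s \<Longrightarrow> m j \<ge> 2"
  shows "simple_graph (paths_and_cycles r s l m)"
  unfolding paths_and_cycles_def
  by (intro simple_disjoint_union simple_disjoint_Union simple_path_graph simple_cycle_graph)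
     (use assms in \<open>force+\<close>)

abbreviation component :: "nat \<times> nat + nat \<times> nat \<Rightarrow> nat + nat" where
  "component \<equiv> map_sum fst fst"

abbreviation position :: "nat \<times> nat + nat \<times> nat \<Rightarrow> nat" where
  "position \<equiv> case_sum snd snd"

lemma verts_paths_and_cycles:
  assumes "h \<in> verts (paths_and_cycles r s l m)"
  shows "component h \<in> components r s"
    and "even (position h) \<Longrightarrow> position h div 2 < even_width l m (component h)"
    and "odd (position h) \<Longrightarrow> position h div 2 < odd_width l m (component h)"
  using assms
  by (auto simp: paths_and_cycles_def disjoint_union_def disjoint_Union_def path_graph_def
      cycle_graph_def components_def even_width_def odd_width_def less_Suc_eq_le
      elim!: evenE oddE)

text \<open>
  All the components are bipartite by the parity of the position; the closing edge of a cycle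
  respects it because the cycle has even length.
\<close>
lemma edges_paths_and_cycles:
  assumes "e \<in> edges (paths_and_cycles r s l m)"
  obtains g h where "e = {g, h}" "g \<in> verts (paths_and_cycles r s l m)"
    "h \<in> verts (paths_and_cycles r s l m)" "component h = component g"
    "even (position g)" "odd (position h)"
    "position h = position g + 1 \<or> position g = position h + 1
      \<or> (\<exists>j. component g = Inr j \<and> position g = 0 \<and> position h = 2 * m j - 1)"
proof -
  let ?H = "paths_and_cycles r s l m"
  have "\<exists>g h. e = {g, h} \<and> g \<in> verts ?H \<and> h \<in> verts ?H \<and> component h = component g \<and>
      (position h = position g + 1 \<or>
        even (position g) \<and> odd (position h) \<and>
        (\<exists>j. component g = Inr j \<and> position g = 0 \<and> position h = 2 * m j - 1))"
  proof -
    consider (path) i a where "i \<in> {1..r}" "a + 1 < l i" "e = {Inl (i, a), Inl (i, a + 1)}"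
      | (cycle) j a where "j \<in> {1..s}" "a < 2 * m j"
          "e = {Inr (j, a), Inr (j, (a + 1) mod (2 * m j))}"
      using assms
      by (fastforce simp: paths_and_cycles_def disjoint_union_def disjoint_Union_def path_graph_def
        cycle_graph_def)
    then show ?thesis
    proof cases
      case path
      then show ?thesis
        by (intro exI[of _ "Inl (i, a)"] exI[of _ "Inl (i, a + 1)"])
           (auto simp: paths_and_cycles_def disjoint_union_def disjoint_Union_def path_graph_def)
    next
      case cycle
      show ?thesis
      proof (cases "a + 1 < 2 * m j")
        case True
        then show ?thesis using cycle
          by (intro exI[of _ "Inr (j, a)"] exI[of _ "Inr (j, a + 1)"])
             (auto simp: paths_and_cycles_def disjoint_union_def disjoint_Union_def cycle_graph_def)
      next
        case False
        then have "a + 1 = 2 * m j" using cycle by simp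
        then have "a = 2 * m j - 1" "odd a" "(a + 1) mod (2 * m j) = 0"
          by presburger+
        then show ?thesis using cycle
          by (intro exI[of _ "Inr (j, 0)"] exI[of _ "Inr (j, a)"])
             (auto simp: paths_and_cycles_def disjoint_union_def disjoint_Union_def cycle_graph_def)
      qed
    qed
  qed
  then obtain g h where gh: "e = {g, h}" "g \<in> verts ?H" "h \<in> verts ?H" "component h = component g"
    and "position h = position g + 1 \<or>
        even (position g) \<and> odd (position h) \<and>
        (\<exists>j. component g = Inr j \<and> position g = 0 \<and> position h = 2 * m j - 1)" by blast
  then consider "position h = position g + 1" "even (position g)"
    | "position h = position g + 1" "odd (position g)"
    | "even (position g)" "odd (position h)"
      "\<exists>j. component g = Inr j \<and> position g = 0 \<and> position h = 2 * m j - 1" by blast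
  then show ?thesis
  proof cases
    case 1 then show ?thesis using that[of g h] gh by simp
  next
    case 2 then show ?thesis using that[of h g] gh by (simp add: insert_commute)
  next
    case 3 then show ?thesis using that[of g h] gh by blast
  qed
qed

text \<open>
  The vertices at positions \<open>2 q\<close> and \<open>2 q + 1\<close> of the component \<open>\<kappa>\<close> go to \<open>X \<kappa> q\<close> and \<open>Y \<kappa> q\<close>.
  In these coordinates the edges of a component join \<open>X \<kappa> q\<close> to \<open>Y \<kappa> q\<close> and to \<open>Y \<kappa> (q - 1)\<close>,
  and the last disjunct of \<open>edge\<close> is the closing edge of a cycle.
\<close>
lemma monochromatic_copy_of_placement:
  fixes X Y :: "nat + nat \<Rightarrow> nat \<Rightarrow> 'v"
  assumes m: "\<And>j. 1 \<le> j \<Longrightarrow> j \<le> s \<Longrightarrow> m j \<ge> 2"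
    and injX: "inj_on (\<lambda>(\<kappa>, q). X \<kappa> q) (SIGMA \<kappa>:components r s. {..<even_width l m \<kappa>})"
    and injY: "inj_on (\<lambda>(\<kappa>, q). Y \<kappa> q) (SIGMA \<kappa>:components r s. {..<odd_width l m \<kappa>})"
    and XY: "\<And>\<kappa> q \<kappa>' q'. \<lbrakk>\<kappa> \<in> components r s; q < even_width l m \<kappa>;
        \<kappa>' \<in> components r s; q' < odd_width l m \<kappa>'\<rbrakk> \<Longrightarrow> X \<kappa> q \<noteq> Y \<kappa>' q'"
    and X: "\<And>\<kappa> q. \<kappa> \<in> components r s \<Longrightarrow> q < even_width l m \<kappa> \<Longrightarrow> X \<kappa> q \<in> verts G"
    and Y: "\<And>\<kappa> q. \<kappa> \<in> components r s \<Longrightarrow> q < odd_width l m \<kappa> \<Longrightarrow> Y \<kappa> q \<in> verts G"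
    and edge: "\<And>\<kappa> q q'. \<lbrakk>\<kappa> \<in> components r s; q < even_width l m \<kappa>; q' < odd_width l m \<kappa>;
        q' = q \<or> q = q' + 1 \<or> (\<exists>j. \<kappa> = Inr j \<and> q = 0 \<and> q' + 1 = m j)\<rbrakk>
      \<Longrightarrow> {X \<kappa> q, Y \<kappa> q'} \<in> edges G \<and> c {X \<kappa> q, Y \<kappa> q'} = z"
  shows "\<exists>F. copy_in F (paths_and_cycles r s l m) G \<and> monochromatic c F"
proof -
  let ?H = "paths_and_cycles r s l m"
  define \<phi> where "\<phi> h = (if even (position h) then X (component h) (position h div 2)
      else Y (component h) (position h div 2))" for h
  have edge_img: "\<phi> ` e \<in> edges G \<and> c (\<phi> ` e) = z" if e: "e \<in> edges ?H" for e
  proof -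
    obtain g h where gh: "e = {g, h}" "g \<in> verts ?H" "h \<in> verts ?H" "component h = component g"
      "even (position g)" "odd (position h)"
      "position h = position g + 1 \<or> position g = position h + 1
        \<or> (\<exists>j. component g = Inr j \<and> position g = 0 \<and> position h = 2 * m j - 1)"
      using edges_paths_and_cycles[OF e] by metis
    have "position h div 2 = position g div 2 \<or> position g div 2 = position h div 2 + 1
        \<or> (\<exists>j. component g = Inr j \<and> position g div 2 = 0 \<and> position h div 2 + 1 = m j)"
    proof -
      have halves: "(a + 1) div 2 = a div 2" "(b + 1) div 2 = b div 2 + 1" "(2 * k - 1) div 2 + 1 = k"
        if "even a" "odd b" "k \<noteq> 0" for a b k :: nat
        using that by presburger+
      have "j \<in> {1..s}" if "component g = Inr j" for j
        using verts_paths_and_cycles(1)[OF gh(2)] that by (auto simp: components_def)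
      then have "m j \<noteq> 0" if "component g = Inr j" for j
        using m[of j] that by fastforce
      then show ?thesis using gh(5-7) halves by (metis div_0 odd_even_add)
    qed
    then have "{X (component g) (position g div 2), Y (component g) (position h div 2)} \<in> edges G
      \<and> c {X (component g) (position g div 2), Y (component g) (position h div 2)} = z"
      using verts_paths_and_cycles[OF gh(2)] verts_paths_and_cycles[OF gh(3)] gh(4-6)
      by (intro edge) auto
    moreover have "\<phi> ` e = {X (component g) (position g div 2), Y (component g) (position h div 2)}"
      using gh(1,4-6) by (auto simp: \<phi>_def)
    ultimately show ?thesis by simp
  qed
  have "inj_on \<phi> (verts ?H)"
  proof (rule inj_onI)
    fix g h assume gh: "g \<in> verts ?H" "h \<in> verts ?H" "\<phi> g = \<phi> h"
    have par: "even (position g) \<longleftrightarrow> even (position h)"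
      using gh(3) XY[of "component g" "position g div 2" "component h" "position h div 2"]
        XY[of "component h" "position h div 2" "component g" "position g div 2"]
        verts_paths_and_cycles[OF gh(1)] verts_paths_and_cycles[OF gh(2)]
      by (auto simp: \<phi>_def split: if_splits)
    have "component g = component h \<and> position g div 2 = position h div 2"
    proof (cases "even (position g)")
      case True
      then show ?thesis
        using inj_onD[OF injX, of "(component g, position g div 2)" "(component h, position h div 2)"]
          verts_paths_and_cycles[OF gh(1)] verts_paths_and_cycles[OF gh(2)] gh(3) par
        by (simp add: \<phi>_def)
    next
      case False
      then show ?thesis
        using inj_onD[OF injY, of "(component g, position g div 2)" "(component h, position h div 2)"]
          verts_paths_and_cycles[OF gh(1)] verts_paths_and_cycles[OF gh(2)] gh(3) par
        by (simp add: \<phi>_def)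
    qed
    moreover from this have "position g = position h"
      using par by (metis even_two_times_div_two odd_two_times_div_two_succ)
    ultimately show "g = h" by (cases g; cases h) (auto intro: prod_eqI)
  qed
  moreover have "\<phi> ` verts ?H \<subseteq> verts G"
    using X Y verts_paths_and_cycles by (auto simp: \<phi>_def)
  ultimately have "copy_in (\<phi> ` verts ?H, (\<lambda>e. \<phi> ` e) ` edges ?H) ?H G"
    using edge_img by (intro copy_in_image simple_paths_and_cycles m) auto
  moreover have "monochromatic c (\<phi> ` verts ?H, (\<lambda>e. \<phi> ` e) ` edges ?H)"
    using edge_img by (auto simp: monochromatic_def)
  ultimately show ?thesis by blast
qed


section \<open>Finding the target in bicliques and crowns\<close>

text \<open>The offsets that lay out blocks of given widths one after the other, without overlap.\<close>
lemma disjoint_blocks: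
  fixes w :: "'i \<Rightarrow> nat"
  assumes "finite I"
  shows "\<exists>off. (\<forall>i\<in>I. off i + w i \<le> sum w I) \<and>
    inj_on (\<lambda>(i, q). off i + q) (SIGMA i:I. {..<w i})"
  using assms
proof (induction I)
  case (insert x I)
  then obtain off where off: "\<And>i. i \<in> I \<Longrightarrow> off i + w i \<le> sum w I"
    and inj: "inj_on (\<lambda>(i, q). off i + q) (SIGMA i:I. {..<w i})" by blast
  have old: "i = j \<and> q = q'"
    if "i \<in> I" "j \<in> I" "q < w i" "q' < w j" "off i + q = off j + q'" for i j q q'
    using inj_onD[OF inj, of "(i, q)" "(j, q')"] that by auto
  have lt: "off i + q < sum w I" if "i \<in> I" "q < w i" for i q
    using off[OF that(1)] that(2) by linarith
  let ?off = "off(x := sum w I)"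
  have "inj_on (\<lambda>(i, q). ?off i + q) (SIGMA i:insert x I. {..<w i})"
  proof (rule inj_onI)
    fix a b
    assume a: "a \<in> (SIGMA i:insert x I. {..<w i})" and b: "b \<in> (SIGMA i:insert x I. {..<w i})"
      and eq: "(case a of (i, q) \<Rightarrow> ?off i + q) = (case b of (i, q) \<Rightarrow> ?off i + q)"
    obtain i q j q' where ab: "a = (i, q)" "b = (j, q')" by (cases a; cases b)
    consider "i = x" "j = x" | "i = x" "j \<in> I" | "i \<in> I" "j = x" | "i \<in> I" "j \<in> I"
      using a b ab by auto
    then show "a = b"
    proof cases
      case 1 then show ?thesis using eq ab by simp
    next
      case 2 then show ?thesis using eq ab b lt[of j q'] insert.hyps by (auto split: if_splits)
    next
      case 3 then show ?thesis using eq ab a lt[of i q] insert.hyps by (auto split: if_splits)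
    next
      case 4
      then have "i \<noteq> x" "j \<noteq> x" using insert.hyps by auto
      then show ?thesis using old[of i j q q'] 4 eq ab a b by auto
    qed
  qed
  moreover have "\<forall>i\<in>insert x I. ?off i + w i \<le> sum w (insert x I)"
    using off insert.hyps by (auto intro: trans_le_add2)
  ultimately show ?case by (intro exI[of _ ?off]) blast
qed simp

lemma inj_on_block_image:
  assumes "inj_on (\<lambda>(i, q). off i + q) (SIGMA i:I. {..<w i})"
    and "\<forall>i\<in>I. off i + w i \<le> n" and f: "inj_on f {..<n::nat}"
  shows "inj_on (\<lambda>(i, q). f (off i + q)) (SIGMA i:I. {..<w i})"
proof -
  have "(\<lambda>(i, q). off i + q) ` (SIGMA i:I. {..<w i}) \<subseteq> {..<n}"
    using assms(2) by fastforce
  then have "inj_on (f \<circ> (\<lambda>(i, q). off i + q)) (SIGMA i:I. {..<w i})"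
    using assms(1) f by (meson comp_inj_on inj_on_subset)
  then show ?thesis by (simp add: comp_def case_prod_unfold)
qed

lemma odd_width_le_even_width: "odd_width l m \<kappa> \<le> even_width l m \<kappa>"
  by (cases \<kappa>) (auto simp: odd_width_def even_width_def)

lemma monochromatic_copy_in_biclique:
  fixes S T :: "'v set"
  assumes m: "\<And>j. 1 \<le> j \<Longrightarrow> j \<le> s \<Longrightarrow> m j \<ge> 2"
    and ST: "S \<subseteq> verts G" "T \<subseteq> verts G" "finite S" "finite T" "S \<inter> T = {}"
    and S: "sum (even_width l m) (components r s) \<le> card S"
    and T: "sum (odd_width l m) (components r s) \<le> card T"
    and edge: "\<And>x y. x \<in> S \<Longrightarrow> y \<in> T \<Longrightarrow> {x, y} \<in> edges G \<and> c {x, y} = z"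
  shows "\<exists>F. copy_in F (paths_and_cycles r s l m) G \<and> monochromatic c F"
proof -
  let ?I = "components r s"
  obtain p where p: "\<forall>\<kappa>\<in>?I. p \<kappa> + even_width l m \<kappa> \<le> sum (even_width l m) ?I"
    "inj_on (\<lambda>(\<kappa>, q). p \<kappa> + q) (SIGMA \<kappa>:?I. {..<even_width l m \<kappa>})"
    using disjoint_blocks[OF finite_components] by blast
  obtain p' where p': "\<forall>\<kappa>\<in>?I. p' \<kappa> + odd_width l m \<kappa> \<le> sum (odd_width l m) ?I"
    "inj_on (\<lambda>(\<kappa>, q). p' \<kappa> + q) (SIGMA \<kappa>:?I. {..<odd_width l m \<kappa>})"
    using disjoint_blocks[OF finite_components] by blast
  obtain f where f: "inj_on f {..<card S}" "f ` {..<card S} \<subseteq> S"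
    using ST(3) by (metis card_lessThan finite_lessThan inj_on_iff_card_le order_refl)
  obtain g where g: "inj_on g {..<card T}" "g ` {..<card T} \<subseteq> T"
    using ST(4) by (metis card_lessThan finite_lessThan inj_on_iff_card_le order_refl)
  have fS: "f (p \<kappa> + q) \<in> S" if "\<kappa> \<in> ?I" "q < even_width l m \<kappa>" for \<kappa> q
  proof -
    have "p \<kappa> + q < card S" using p(1) S that by (metis add_less_cancel_left le_trans less_le_trans)
    then show ?thesis using f(2) by blast
  qed
  have gT: "g (p' \<kappa> + q) \<in> T" if "\<kappa> \<in> ?I" "q < odd_width l m \<kappa>" for \<kappa> q
  proof -
    have "p' \<kappa> + q < card T" using p'(1) T that by (metis add_less_cancel_left le_trans less_le_trans)
    then show ?thesis using g(2) by blast
  qed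
  show ?thesis
  proof (rule monochromatic_copy_of_placement[OF m, where X = "\<lambda>\<kappa> q. f (p \<kappa> + q)" and Y = "\<lambda>\<kappa> q. g (p' \<kappa> + q)"])
    show "inj_on (\<lambda>(\<kappa>, q). f (p \<kappa> + q)) (SIGMA \<kappa>:?I. {..<even_width l m \<kappa>})"
      using inj_on_block_image[OF p(2) _ f(1)] p(1) S le_trans by blast
    show "inj_on (\<lambda>(\<kappa>, q). g (p' \<kappa> + q)) (SIGMA \<kappa>:?I. {..<odd_width l m \<kappa>})"
      using inj_on_block_image[OF p'(2) _ g(1)] p'(1) T le_trans by blast
    show "f (p \<kappa> + q) \<noteq> g (p' \<kappa>' + q')"
      if "\<kappa> \<in> ?I" "q < even_width l m \<kappa>" "\<kappa>' \<in> ?I" "q' < odd_width l m \<kappa>'" for \<kappa> q \<kappa>' q'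
      using fS[OF that(1,2)] gT[OF that(3,4)] ST(5) by force
    show "f (p \<kappa> + q) \<in> verts G" if "\<kappa> \<in> ?I" "q < even_width l m \<kappa>" for \<kappa> q
      using fS[OF that] ST(1) by blast
    show "g (p' \<kappa> + q) \<in> verts G" if "\<kappa> \<in> ?I" "q < odd_width l m \<kappa>" for \<kappa> q
      using gT[OF that] ST(2) by blast
    show "{f (p \<kappa> + q), g (p' \<kappa> + q')} \<in> edges G \<and> c {f (p \<kappa> + q), g (p' \<kappa> + q')} = z"
      if "\<kappa> \<in> ?I" "q < even_width l m \<kappa>" "q' < odd_width l m \<kappa>" for \<kappa> q q'
      using edge[OF fS[OF that(1,2)] gT[OF that(1,3)]] .
  qed
qed

text \<open>
  The vertex with coordinate \<open>a\<close> among the odd positions goes to \<open>y\<close> of the index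
  \<open>a + 2\<close>, modulo \<open>B\<close>. It is then adjacent to the images of its neighbours, which have the
  coordinates \<open>a\<close> and \<open>a + 1\<close>, because \<open>B \<ge> 3\<close>. The closing edge of a cycle joins an even
  coordinate \<open>p\<close> to the odd coordinate \<open>p + m j - 1\<close>, which is sent to \<open>p + m j + 1\<close>; this index is
  congruent to \<open>p\<close> only if \<open>m j + 1 = B\<close>.
\<close>
lemma monochromatic_copy_in_crown:
  fixes x y :: "nat \<Rightarrow> 'v"
  assumes m: "\<And>j. 1 \<le> j \<Longrightarrow> j \<le> s \<Longrightarrow> m j \<ge> 2"
    and B: "B = sum (even_width l m) (components r s)" "3 \<le> B"
    and no_wrap: "\<And>j. 1 \<le> j \<Longrightarrow> j \<le> s \<Longrightarrow> m j + 1 \<noteq> B"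
    and inj: "inj_on x {..<B}" "inj_on y {..<B}"
    and xy: "\<And>i j. i < B \<Longrightarrow> j < B \<Longrightarrow> x i \<noteq> y j"
    and verts: "\<And>i. i < B \<Longrightarrow> x i \<in> verts G \<and> y i \<in> verts G"
    and edge: "\<And>i j. \<lbrakk>i < B; j < B; i \<noteq> j\<rbrakk> \<Longrightarrow> {x i, y j} \<in> edges G \<and> c {x i, y j} = z"
  shows "\<exists>F. copy_in F (paths_and_cycles r s l m) G \<and> monochromatic c F"
proof -
  let ?I = "components r s"
  obtain p where p: "\<forall>\<kappa>\<in>?I. p \<kappa> + even_width l m \<kappa> \<le> B"
    "inj_on (\<lambda>(\<kappa>, q). p \<kappa> + q) (SIGMA \<kappa>:?I. {..<even_width l m \<kappa>})"
    using disjoint_blocks[OF finite_components] B(1) by blast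
  define sh where "sh a = (if a + 2 < B then a + 2 else a + 2 - B)" for a
  have sh: "sh a < B" if "a < B" for a using that B(2) unfolding sh_def by presburger
  have "inj_on sh {..<B}" by (rule inj_onI) (auto simp: sh_def split: if_splits)
  moreover have "sh ` {..<B} \<subseteq> {..<B}" using sh by auto
  ultimately have "inj_on (y \<circ> sh) {..<B}"
    using comp_inj_on inj(2) inj_on_subset by metis
  then have inj_ysh: "inj_on (\<lambda>a. y (sh a)) {..<B}" by (simp add: comp_def)
  have ltE: "p \<kappa> + q < B" if "\<kappa> \<in> ?I" "q < even_width l m \<kappa>" for \<kappa> q
    using p(1) that by fastforce
  have ltO: "p \<kappa> + q < B" if "\<kappa> \<in> ?I" "q < odd_width l m \<kappa>" for \<kappa> q
    using ltE that odd_width_le_even_width less_le_trans by blast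
  have ne: "p \<kappa> + q \<noteq> sh (p \<kappa> + q')"
    if h: "\<kappa> \<in> ?I" "q < even_width l m \<kappa>" "q' < odd_width l m \<kappa>"
        "q' = q \<or> q = q' + 1 \<or> (\<exists>j. \<kappa> = Inr j \<and> q = 0 \<and> q' + 1 = m j)" for \<kappa> q q'
    using h(4)
  proof (elim disjE exE conjE)
    assume "q' = q" then show ?thesis using B(2) ltE[OF h(1,2)] by (cases "p \<kappa> + q' + 2 < B") (auto simp: sh_def)
  next
    assume "q = q' + 1" then show ?thesis using B(2) ltE[OF h(1,2)] by (cases "p \<kappa> + q' + 2 < B") (auto simp: sh_def)
  next
    fix j assume j: "\<kappa> = Inr j" "q = 0" "q' + 1 = m j"
    then have "1 \<le> j" "j \<le> s" using h(1) by (auto simp: components_def)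
    then have "m j + 1 \<noteq> B" "p \<kappa> + m j \<le> B"
      using no_wrap p(1) h(1) j(1) by (auto simp: even_width_def)
    then show ?thesis using j B(2) by (auto simp: sh_def)
  qed
  show ?thesis
  proof (rule monochromatic_copy_of_placement[OF m, where X = "\<lambda>\<kappa> q. x (p \<kappa> + q)" and Y = "\<lambda>\<kappa> q. y (sh (p \<kappa> + q))"])
    show "inj_on (\<lambda>(\<kappa>, q). x (p \<kappa> + q)) (SIGMA \<kappa>:?I. {..<even_width l m \<kappa>})"
      by (rule inj_on_block_image[OF p(2,1) inj(1)])
    have "(SIGMA \<kappa>:?I. {..<odd_width l m \<kappa>}) \<subseteq> (SIGMA \<kappa>:?I. {..<even_width l m \<kappa>})"
      using odd_width_le_even_width less_le_trans by fastforce
    then show "inj_on (\<lambda>(\<kappa>, q). y (sh (p \<kappa> + q))) (SIGMA \<kappa>:?I. {..<odd_width l m \<kappa>})"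
      using inj_on_block_image[OF p(2,1) inj_ysh] inj_on_subset by blast
    show "x (p \<kappa> + q) \<noteq> y (sh (p \<kappa>' + q'))"
      if "\<kappa> \<in> ?I" "q < even_width l m \<kappa>" "\<kappa>' \<in> ?I" "q' < odd_width l m \<kappa>'" for \<kappa> q \<kappa>' q'
      using xy[OF ltE[OF that(1,2)] sh[OF ltO[OF that(3,4)]]] .
    show "x (p \<kappa> + q) \<in> verts G" if "\<kappa> \<in> ?I" "q < even_width l m \<kappa>" for \<kappa> q
      using verts[OF ltE[OF that]] by blast
    show "y (sh (p \<kappa> + q)) \<in> verts G" if "\<kappa> \<in> ?I" "q < odd_width l m \<kappa>" for \<kappa> q
      using verts[OF sh[OF ltO[OF that]]] by blast
    show "{x (p \<kappa> + q), y (sh (p \<kappa> + q'))} \<in> edges G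
        \<and> c {x (p \<kappa> + q), y (sh (p \<kappa> + q'))} = z"
      if "\<kappa> \<in> ?I" "q < even_width l m \<kappa>" "q' < odd_width l m \<kappa>"
        "q' = q \<or> q = q' + 1 \<or> (\<exists>j. \<kappa> = Inr j \<and> q = 0 \<and> q' + 1 = m j)" for \<kappa> q q'
      using edge[OF ltE[OF that(1,2)] sh[OF ltO[OF that(1,3)]] ne[OF that]] .
  qed
qed

section \<open>Upper bound\<close>

lemma almost_row_coloring_biclique:
  fixes d :: "'a \<Rightarrow> 'b \<Rightarrow> nat"
  assumes arc: "almost_row_coloring U V d"
    and colors: "\<And>u v. u \<in> U \<Longrightarrow> v \<in> V \<Longrightarrow> d u v \<in> {1..k}"
    and fin: "finite U" "finite V" and card: "card U = N" "card V = N"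
    and N: "k * (t - 1) < N" "q + (t - 1) \<le> N" "0 < q"
  obtains S T z where "S \<subseteq> U" "T \<subseteq> V" "\<And>u v. u \<in> S \<Longrightarrow> v \<in> T \<Longrightarrow> d u v = z"
    "q \<le> card S \<and> t \<le> card T \<or> t \<le> card S \<and> q \<le> card T"
proof -
  obtain f z where fz: "\<And>v. v \<in> V \<Longrightarrow> (\<forall>u\<in>U. d u v = f u) \<or> (\<forall>u\<in>U. d u v = z)"
    using arc unfolding almost_row_coloring_def by blast
  define D where "D = {v \<in> V. \<forall>u\<in>U. d u v = z}"
  show ?thesis
  proof (cases "t \<le> card D")
    case True
    have "D \<subseteq> V" "\<And>u v. u \<in> U \<Longrightarrow> v \<in> D \<Longrightarrow> d u v = z" by (auto simp: D_def)
    moreover have "q \<le> card U" using N(2) card(1) by simp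
    ultimately show ?thesis using that[OF order_refl] True by blast
  next
    case False
    have "card (V - D) = N - card D"
      using card(2) fin(2) by (simp add: D_def card_Diff_subset)
    then have big: "q \<le> card (V - D)" "0 < card (V - D)"
      using False N by linarith+
    have f: "d u v = f u" if "u \<in> U" "v \<in> V - D" for u v
      using fz[of v] that by (auto simp: D_def)
    obtain v where v: "v \<in> V - D" using big(2) by (metis card_gt_0_iff ex_in_conv)
    have "U \<subseteq> (\<Union>i\<in>{1..k}. {u \<in> U. f u = i})"
      using f[OF _ v] colors v by force
    then have "N \<le> card (\<Union>i\<in>{1..k}. {u \<in> U. f u = i})"
      using card_mono[of "\<Union>i\<in>{1..k}. {u \<in> U. f u = i}" U] fin(1) card(1) by simp
    also have "\<dots> \<le> (\<Sum>i=1..k. card {u \<in> U. f u = i})" by (rule card_UN_le) simp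
    finally have sum: "N \<le> (\<Sum>i=1..k. card {u \<in> U. f u = i})" .
    have "\<exists>i\<in>{1..k}. t \<le> card {u \<in> U. f u = i}"
    proof (rule ccontr)
      assume "\<not> ?thesis"
      then have "card {u \<in> U. f u = i} \<le> t - 1" if "i \<in> {1..k}" for i using that by force
      then have "(\<Sum>i=1..k. card {u \<in> U. f u = i}) \<le> (\<Sum>i=1..k. t - 1)" by (rule sum_mono)
      then show False using sum N(1) by simp
    qed
    then obtain i where "t \<le> card {u \<in> U. f u = i}" by blast
    moreover have "d u w = i" if "u \<in> {u \<in> U. f u = i}" "w \<in> V - D" for u w using f[of u w] that by simp
    ultimately show ?thesis using that[of "{u \<in> U. f u = i}" "V - D" i] big(1) by blast
  qed
qed

text \<open>
  Choose one edge \<open>x i y i\<close> of each colour \<open>i \<noteq> z\<close>. The edge \<open>x i y j\<close> meets edges of the two colours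
  \<open>i\<close> and \<open>j\<close>, so any colour of it other than \<open>z\<close> would have to be equal to both.
\<close>
lemma dominated_coloring_crown:
  assumes dom: "dominated_coloring U V d z"
    and C: "C = (\<lambda>(u, v). d u v) ` (U \<times> V) - {z}"
  shows "\<exists>x y. (\<forall>i\<in>C. x i \<in> U \<and> y i \<in> V \<and> d (x i) (y i) = i) \<and>
    (\<forall>i\<in>C. \<forall>j\<in>C. i \<noteq> j \<longrightarrow> x i \<noteq> x j \<and> y i \<noteq> y j \<and> d (x i) (y j) = z)"
proof -
  have "\<forall>i\<in>C. \<exists>e. fst e \<in> U \<and> snd e \<in> V \<and> d (fst e) (snd e) = i" using C by force
  then obtain e where "\<forall>i\<in>C. fst (e i) \<in> U \<and> snd (e i) \<in> V \<and> d (fst (e i)) (snd (e i)) = i"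
    by (rule bchoice[elim_format]) blast
  then have e: "fst (e i) \<in> U" "snd (e i) \<in> V" "d (fst (e i)) (snd (e i)) = i" "i \<noteq> z"
    if "i \<in> C" for i using that C by auto
  have row: "d u v = z \<or> d u v' = z \<or> d u v = d u v'" if "u \<in> U" "v \<in> V" "v' \<in> V" for u v v'
    using dom that unfolding dominated_coloring_def by blast
  have col: "d u v = z \<or> d u' v = z \<or> d u v = d u' v" if "v \<in> V" "u \<in> U" "u' \<in> U" for u u' v
    using dom that unfolding dominated_coloring_def by blast
  have "fst (e i) \<noteq> fst (e j) \<and> snd (e i) \<noteq> snd (e j) \<and> d (fst (e i)) (snd (e j)) = z"
    if ij: "i \<in> C" "j \<in> C" "i \<noteq> j" for i j
    using row[of "fst (e i)" "snd (e i)" "snd (e j)"] col[of "snd (e j)" "fst (e i)" "fst (e j)"]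
      col[of "snd (e i)" "fst (e i)" "fst (e j)"]
      e[OF ij(1)] e[OF ij(2)] ij(3) by metis
  then show ?thesis
    using e by (intro exI[of _ "\<lambda>i. fst (e i)"] exI[of _ "\<lambda>i. snd (e i)"]) blast
qed

text \<open>
  Take edges \<open>x i y i\<close> of three colours \<open>i \<noteq> z\<close> and a row \<open>p\<close> besides the \<open>x i\<close>. An entry
  \<open>d p (y i) \<noteq> z\<close> must be equal to \<open>i\<close>, and the row \<open>p\<close> has at most one colour other than \<open>z\<close>, so this
  happens for at most one of the three. If \<open>i\<close> is that one, the rows \<open>p\<close> and \<open>x i\<close> and the other two
  columns form the four-cycle.
\<close>
lemma dominated_coloring_four_cycle:
  assumes dom: "dominated_coloring U V d z"
    and C: "C = (\<lambda>(u, v). d u v) ` (U \<times> V) - {z}" and three: "3 \<le> card C" and U: "4 \<le> card U"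
  shows "\<exists>S T. S \<subseteq> U \<and> T \<subseteq> V \<and> card S = 2 \<and> card T = 2 \<and> (\<forall>u\<in>S. \<forall>v\<in>T. d u v = z)"
proof -
  obtain x y where x: "\<forall>i\<in>C. x i \<in> U \<and> y i \<in> V \<and> d (x i) (y i) = i"
    and y: "\<forall>i\<in>C. \<forall>j\<in>C. i \<noteq> j \<longrightarrow> x i \<noteq> x j \<and> y i \<noteq> y j \<and> d (x i) (y j) = z"
    using dominated_coloring_crown[OF dom C] by blast
  have xy: "x i \<in> U \<and> y i \<in> V \<and> d (x i) (y i) = i" if "i \<in> C" for i
    using x that by blast
  have cross: "x i \<noteq> x j \<and> y i \<noteq> y j \<and> d (x i) (y j) = z" if "i \<in> C" "j \<in> C" "i \<noteq> j" for i j
    using y that by blast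
  obtain A where "A \<subseteq> C" "card A = 3" using three by (meson obtain_subset_with_card_n)
  then obtain i j k where ijk: "i \<in> C" "j \<in> C" "k \<in> C" "i \<noteq> j" "i \<noteq> k" "j \<noteq> k"
    unfolding card_3_iff by blast
  have "card {x i, x j, x k} < 4" by (simp add: card_insert_if)
  then have "\<not> U \<subseteq> {x i, x j, x k}" using U card_mono[of "{x i, x j, x k}" U] by auto
  then obtain p where p: "p \<in> U" "p \<noteq> x i" "p \<noteq> x j" "p \<noteq> x k" by blast
  have square: ?thesis
    if "a \<in> C" "b \<in> C" "e \<in> C" "a \<noteq> b" "a \<noteq> e" "b \<noteq> e" "p \<noteq> x a" "d p (y b) = z" "d p (y e) = z"
    for a b e
    using that(7-9) p(1) cross[OF that(1,2,4)] cross[OF that(1,3,5)] cross[OF that(2,3,6)]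
      xy[OF that(1)] xy[OF that(2)] xy[OF that(3)]
    by (intro exI[of _ "{p, x a}"] exI[of _ "{y b, y e}"]) auto
  have most: "d p (y a) = z \<or> d p (y b) = z" if ab: "a \<in> C" "b \<in> C" "a \<noteq> b" for a b
  proof (rule ccontr)
    assume n: "\<not> ?thesis"
    have col: "d p (y w) = w" if w: "w \<in> C" "d p (y w) \<noteq> z" for w
      using dom w(2) xy[OF w(1)] w(1) p(1) C unfolding dominated_coloring_def by (metis DiffD2 singletonI)
    have "d p (y a) = a" "d p (y b) = b" using col ab n by blast+
    moreover have "d p (y a) = d p (y b)"
      using dom n xy[OF ab(1)] xy[OF ab(2)] p(1) unfolding dominated_coloring_def by blast
    ultimately show False using ab(3) by simp
  qed
  consider "d p (y j) = z" "d p (y k) = z" | "d p (y i) = z" "d p (y k) = z"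
    | "d p (y i) = z" "d p (y j) = z"
    using most[OF ijk(1,2,4)] most[OF ijk(1,3,5)] most[OF ijk(2,3,6)] by blast
  then show ?thesis
  proof cases
    case 1 then show ?thesis using square[of i j k] ijk p by blast
  next
    case 2 then show ?thesis using square[of j i k] ijk p by blast
  next
    case 3 then show ?thesis using square[of k i j] ijk p by blast
  qed
qed


text \<open>
  Besides the cycle \<open>j\<close> there is either no component or one of width at least two. This excludes the one
  sum of widths for which the shift in a crown fails.
\<close>
lemma sum_even_width_neq_Suc_cycle:
  assumes l: "\<And>i. 1 \<le> i \<Longrightarrow> i \<le> r \<Longrightarrow> l i \<ge> 2"
    and m: "\<And>j. 1 \<le> j \<Longrightarrow> j \<le> s \<Longrightarrow> m j \<ge> 2"
    and j: "1 \<le> j" "j \<le> s"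
  shows "sum (even_width l m) (components r s) \<noteq> m j + 1"
proof -
  let ?I = "components r s"
  have j': "Inr j \<in> ?I" using j by (auto simp: components_def)
  have two: "2 \<le> even_width l m \<kappa>" if "\<kappa> \<in> ?I" for \<kappa>
  proof (cases \<kappa>)
    case (Inl i)
    then have "2 \<le> l i" using that l by (auto simp: components_def)
    then show ?thesis using Inl by (simp add: even_width_def)
  qed (use that m in \<open>auto simp: components_def even_width_def\<close>)
  have sum: "sum (even_width l m) ?I = m j + sum (even_width l m) (?I - {Inr j})"
    using sum.remove[OF finite_components j', of "even_width l m"] by (simp add: even_width_def)
  show ?thesis
  proof (cases "?I - {Inr j} = {}")
    case True
    show ?thesis using sum unfolding True by simp
  next
    case False
    then obtain \<kappa> where \<kappa>: "\<kappa> \<in> ?I - {Inr j}" by blast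
    then have "even_width l m \<kappa> \<le> sum (even_width l m) (?I - {Inr j})"
      using finite_components by (intro member_le_sum) auto
    then show ?thesis using two[of \<kappa>] \<kappa> sum by simp
  qed
qed

lemma monochromatic_copy_exists:
  fixes N :: nat
  assumes l: "\<And>i. 1 \<le> i \<Longrightarrow> i \<le> r \<Longrightarrow> l i \<ge> 2"
    and m: "\<And>j. 1 \<le> j \<Longrightarrow> j \<le> s \<Longrightarrow> m j \<ge> 2"
    and q: "q = sum (even_width l m) (components r s)"
    and t: "t = sum (odd_width l m) (components r s)" "2 \<le> t"
    and k: "q + 2 \<le> k" and N: "k * (t - 1) < N"
    and exact: "exact_edge_coloring k (complete_bipartite N N) c"
    and no_rainbow: "\<nexists>F. copy_in F (path_graph 5) (complete_bipartite N N) \<and> rainbow c F"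
  shows "\<exists>F. copy_in F (paths_and_cycles r s l m) (complete_bipartite N N) \<and> monochromatic c F"
proof -
  let ?K = "complete_bipartite N N"
  define d where "d u v = c {Inl u, Inr v}" for u v :: nat
  have tq: "t \<le> q" unfolding q t by (intro sum_mono odd_width_le_even_width)
  have k4: "4 \<le> k" using k t tq by linarith
  \<comment> \<open>This leaves at least \<open>q\<close> columns after the removal of \<open>t - 1\<close>, and at least five vertices on each side.\<close>
  have kN: "k + (t - 2) < N"
  proof -
    have "k * (t - 1) = k + k * (t - 2)"
      using t(2) by (metis Suc_diff_Suc Suc_1 Suc_le_lessD mult_Suc_right)
    moreover have "t - 2 \<le> k * (t - 2)" using k4 by simp
    ultimately show ?thesis using N by linarith
  qed
  have edge: "{Inl u, Inr v} \<in> edges ?K" if "u < N" "v < N" for u v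
    using that by (auto simp: complete_bipartite_def)
  have range: "(\<lambda>(u, v). d u v) ` ({..<N} \<times> {..<N}) = {1..k}"
  proof -
    have "c ` edges ?K = (\<lambda>(u, v). d u v) ` ({..<N} \<times> {..<N})"
      by (fastforce simp: complete_bipartite_def d_def)
    then show ?thesis using exact by (simp add: exact_edge_coloring_def)
  qed
  then have range': "d u v \<in> {1..k}" if "u < N" "v < N" for u v using that by blast
  have biclique: ?thesis
    if S: "S \<subseteq> {..<N}" and T: "T \<subseteq> {..<N}" and z: "\<And>u v. u \<in> S \<Longrightarrow> v \<in> T \<Longrightarrow> d u v = z"
      and card: "q \<le> card S \<and> t \<le> card T \<or> t \<le> card S \<and> q \<le> card T" for S T z
  proof -
    have fin: "finite S" "finite T" using S T finite_subset by auto
    have sub: "Inl ` S \<subseteq> verts ?K" "Inr ` T \<subseteq> verts ?K"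
      using S T by (auto simp: complete_bipartite_def)
    have col: "{x, y} \<in> edges ?K \<and> c {x, y} = z" "{y, x} \<in> edges ?K \<and> c {y, x} = z"
      if "x \<in> Inl ` S" "y \<in> Inr ` T" for x y
      using that S T edge z by (auto simp: d_def insert_commute)
    have card_image: "card (Inl ` S) = card S" "card (Inr ` T) = card T" by (simp_all add: card_image)
    have disj: "Inl ` S \<inter> Inr ` T = {}" "Inr ` T \<inter> Inl ` S = {}" by auto
    from card show ?thesis
    proof (elim disjE conjE)
      assume "q \<le> card S" "t \<le> card T"
      then show ?thesis
        by (intro monochromatic_copy_in_biclique[where z = z,
              OF m sub finite_imageI[OF fin(1)] finite_imageI[OF fin(2)] disj(1) _ _ col(1)])
          (simp_all add: q t(1) card_image)
    next
      assume "t \<le> card S" "q \<le> card T"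
      then show ?thesis
        by (intro monochromatic_copy_in_biclique[where z = z,
              OF m sub(2,1) finite_imageI[OF fin(2)] finite_imageI[OF fin(1)] disj(2) _ _ col(2)])
          (simp_all add: q t(1) card_image)
    qed
  qed
  have room: "q + (t - 1) \<le> N" "0 < q" using kN k t(2) tq by linarith+
  have five: "5 \<le> card {..<N}" using k4 kN by simp
  have four: "4 \<le> card ((\<lambda>(u, v). d u v) ` ({..<N} \<times> {..<N}))" using k4 unfolding range by simp
  have walks: "no_rainbow_P5 {..<N} {..<N} d" "no_rainbow_P5 {..<N} {..<N} (\<lambda>v u. d u v)"
    using no_rainbow_P5_complete_bipartite[OF no_rainbow] unfolding d_def .
  consider (rows) "almost_row_coloring {..<N} {..<N} d"
    | (columns) "almost_row_coloring {..<N} {..<N} (\<lambda>v u. d u v)"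
    | (dominated) z where "dominated_coloring {..<N} {..<N} d z"
    using no_rainbow_P5_trichotomy[OF walks five five four] by blast
  then show ?thesis
  proof cases
    case rows
    obtain S T z where "S \<subseteq> {..<N}" "T \<subseteq> {..<N}" "\<And>u v. u \<in> S \<Longrightarrow> v \<in> T \<Longrightarrow> d u v = z"
      "q \<le> card S \<and> t \<le> card T \<or> t \<le> card S \<and> q \<le> card T"
      by (rule almost_row_coloring_biclique[OF rows _ _ _ _ _ N room]) (use range' in auto)
    then show ?thesis using biclique by blast
  next
    case columns
    obtain S T z where "S \<subseteq> {..<N}" "T \<subseteq> {..<N}" "\<And>u v. u \<in> S \<Longrightarrow> v \<in> T \<Longrightarrow> d v u = z"
      "q \<le> card S \<and> t \<le> card T \<or> t \<le> card S \<and> q \<le> card T"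
      by (rule almost_row_coloring_biclique[OF columns _ _ _ _ _ N room]) (use range' in auto)
    then show ?thesis using biclique[of T S z] by blast
  next
    case dominated
    define C where "C = (\<lambda>(u, v). d u v) ` ({..<N} \<times> {..<N}) - {z}"
    have cardC: "q + 1 \<le> card C" using k unfolding C_def range by (auto simp: card_Diff_singleton_if; linarith)
    show ?thesis
    proof (cases "q = 2")
      \<comment> \<open>Then also \<open>t = 2\<close>, and a square suffices as the biclique.\<close>
      case True
      then have "3 \<le> card C" using cardC by simp
      then obtain S T where "S \<subseteq> {..<N}" "T \<subseteq> {..<N}" "card S = 2" "card T = 2"
        "\<forall>u\<in>S. \<forall>v\<in>T. d u v = z"
        using dominated_coloring_four_cycle[OF dominated C_def] five by auto
      then show ?thesis using biclique[of S T z] True tq by simp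
    next
      case False
      then have q3: "3 \<le> q" using t(2) tq by linarith
      obtain x y where xy: "\<forall>i\<in>C. x i \<in> {..<N} \<and> y i \<in> {..<N} \<and> d (x i) (y i) = i"
        "\<forall>i\<in>C. \<forall>j\<in>C. i \<noteq> j \<longrightarrow> x i \<noteq> x j \<and> y i \<noteq> y j \<and> d (x i) (y j) = z"
        using dominated_coloring_crown[OF dominated C_def] by blast
      have "finite C" unfolding C_def by simp
      then obtain f where f: "inj_on f {..<q}" "f ` {..<q} \<subseteq> C"
        using cardC by (metis add_leD1 card_lessThan finite_lessThan inj_on_iff_card_le)
      have fC: "f i \<in> C" if "i < q" for i using f(2) that by blast
      have fne: "f i \<noteq> f j" if "i < q" "j < q" "i \<noteq> j" for i j using f(1) that by (auto dest: inj_onD)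
      show ?thesis
      proof (rule monochromatic_copy_in_crown[OF m q q3,
            where x = "\<lambda>i. Inl (x (f i))" and y = "\<lambda>i. Inr (y (f i))"])
        show "m j + 1 \<noteq> q" if "1 \<le> j" "j \<le> s" for j
          using sum_even_width_neq_Suc_cycle[where l = l and m = m and r = r and s = s, OF l m that] q
          by metis
        show "inj_on (\<lambda>i. Inl (x (f i)) :: nat + nat) {..<q}"
          "inj_on (\<lambda>i. Inr (y (f i)) :: nat + nat) {..<q}"
          using xy(2) fC fne by (auto intro!: inj_onI) metis+
        show "Inl (x (f i)) \<in> verts ?K \<and> Inr (y (f i)) \<in> verts ?K" if "i < q" for i
          using xy(1) fC[OF that] by (auto simp: complete_bipartite_def)
        show "{Inl (x (f i)), Inr (y (f j))} \<in> edges ?K \<and> c {Inl (x (f i)), Inr (y (f j))} = z"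
          if "i < q" "j < q" "i \<noteq> j" for i j
          using xy fC[OF that(1)] fC[OF that(2)] fne[OF that] edge by (auto simp: d_def)
      qed auto
    qed
  qed
qed

section \<open>Lower bound\<close>

text \<open>
  The left ends of an edge are given as a preimage, which is a singleton for the edges of a complete
  bipartite graph; \<open>Min\<close> extracts its element.
\<close>
definition left_block_coloring :: "nat \<Rightarrow> (nat + nat) set \<Rightarrow> nat" where
  "left_block_coloring b e = Min (Inl -` e) div b + 1"

lemma left_block_coloring_edge:
  "left_block_coloring b {Inl u, Inr v} = u div b + 1"
  "left_block_coloring b {Inr v, Inl u} = u div b + 1"
proof -
  have "Inl -` {Inl u, Inr v} = {u}" "Inl -` {Inr v, Inl u} = {u}" by auto
  then show "left_block_coloring b {Inl u, Inr v} = u div b + 1"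
    "left_block_coloring b {Inr v, Inl u} = u div b + 1"
    by (simp_all add: left_block_coloring_def)
qed

lemma left_block_coloring_exact:
  assumes "0 < b" "0 < k"
  shows "exact_edge_coloring k (complete_bipartite (k * b) (k * b)) (left_block_coloring b)"
  unfolding exact_edge_coloring_def
proof
  show "left_block_coloring b ` edges (complete_bipartite (k * b) (k * b)) \<subseteq> {1..k}"
    using assms
    by (auto simp: complete_bipartite_def left_block_coloring_edge less_mult_imp_div_less Suc_le_eq)
  show "{1..k} \<subseteq> left_block_coloring b ` edges (complete_bipartite (k * b) (k * b))"
  proof
    fix i assume i: "i \<in> {1..k}"
    have "(i - 1) * b < k * b" using i assms by auto
    then have "\<exists>u v. {Inl ((i - 1) * b), Inr 0 :: nat + nat} = {Inl u, Inr v} \<and> u < k * b \<and> v < k * b"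
      by (intro exI[of _ "(i - 1) * b"] exI[of _ 0]) auto
    then have "{Inl ((i - 1) * b), Inr 0} \<in> edges (complete_bipartite (k * b) (k * b))"
      by (simp only: complete_bipartite_def snd_conv mem_Collect_eq)
    moreover have "left_block_coloring b {Inl ((i - 1) * b), Inr 0} = i"
      using i assms by (simp add: left_block_coloring_edge)
    ultimately show "i \<in> left_block_coloring b ` edges (complete_bipartite (k * b) (k * b))"
      by (metis image_eqI)
  qed
qed

text \<open>
  One of the second and the third vertex of the path is a left vertex. Its two path edges have the
  same colour.
\<close>
lemma left_block_coloring_no_rainbow:
  assumes "copy_in F (path_graph 5) (complete_bipartite n n')"
  shows "\<not> rainbow (left_block_coloring b) F"
proof
  assume rainbow: "rainbow (left_block_coloring b) F"
  obtain \<phi> where inj: "inj_on \<phi> (verts (path_graph 5))"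
    and edges: "\<And>e. e \<in> edges (path_graph 5) \<Longrightarrow> \<phi> ` e \<in> edges F"
    and F: "edges F \<subseteq> edges (complete_bipartite n n')"
    using copy_in_obtain_embedding[OF assms simple_path_graph] by metis
  have e: "{\<phi> 0, \<phi> 1} \<in> edges F" "{\<phi> 1, \<phi> 2} \<in> edges F" "{\<phi> 2, \<phi> 3} \<in> edges F"
    using edges[of "{0, 1}"] edges[of "{1, 2}"] edges[of "{2, 3}"]
    by (simp_all add: edges_path_graph_5)
  have ne: "\<phi> 0 \<noteq> \<phi> 2" "\<phi> 1 \<noteq> \<phi> 3" "\<phi> 1 \<noteq> \<phi> 2"
    using inj_onD[OF inj, of 0 2] inj_onD[OF inj, of 1 3] inj_onD[OF inj, of 1 2]
    by (auto simp: path_graph_def)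
  have color: "left_block_coloring b {x, Inl u} = u div b + 1" if "{x, Inl u} \<in> edges F" for x u
    using that F by (auto simp: complete_bipartite_def doubleton_eq_iff left_block_coloring_edge)
  have bad: False if "{x, Inl u} \<in> edges F" "{Inl u, y} \<in> edges F" "x \<noteq> y" for x y u
  proof -
    have "left_block_coloring b {x, Inl u} = left_block_coloring b {Inl u, y}"
      using color[of x u] color[of y u] that by (simp add: insert_commute)
    then have "{x, Inl u} = {Inl u, y}" using rainbow that by (auto simp: rainbow_def inj_on_def)
    then show False using that(3) by (auto simp: doubleton_eq_iff)
  qed
  show False
  proof (cases "\<phi> 1")
    case (Inl u) then show False using bad[of "\<phi> 0" u "\<phi> 2"] e ne by simp
  next
    case (Inr v)
    then obtain u where "\<phi> 2 = Inl u"
      using e(2) F by (auto simp: complete_bipartite_def doubleton_eq_iff)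
    then show False using bad[of "\<phi> 1" u "\<phi> 3"] e ne by simp
  qed
qed

text \<open>
  The edges between the positions \<open>2 q\<close> and \<open>2 q + 1\<close> of all components form a matching. In a
  monochromatic copy their left ends are distinct elements of a single block, which has only
  \<open>b\<close> of them.
\<close>
lemma left_block_coloring_no_monochromatic:
  assumes m: "\<And>j. 1 \<le> j \<Longrightarrow> j \<le> s \<Longrightarrow> m j \<ge> 2"
    and b: "0 < b" "b < sum (odd_width l m) (components r s)"
    and copy: "copy_in F (paths_and_cycles r s l m) (complete_bipartite n n')"
  shows "\<not> monochromatic (left_block_coloring b) F"
proof
  assume mono: "monochromatic (left_block_coloring b) F"
  let ?H = "paths_and_cycles r s l m"
  let ?M = "SIGMA \<kappa>:components r s. {..<odd_width l m \<kappa>}"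
  obtain \<phi> where inj: "inj_on \<phi> (verts ?H)"
    and edges: "\<And>e. e \<in> edges ?H \<Longrightarrow> \<phi> ` e \<in> edges F"
    and F: "edges F \<subseteq> edges (complete_bipartite n n')"
    using copy_in_obtain_embedding[OF copy simple_paths_and_cycles[OF m]] by metis
  define v where "v \<kappa> a = map_sum (\<lambda>i. (i, a)) (\<lambda>j. (j, a)) \<kappa>" for \<kappa> :: "nat + nat" and a :: nat
  have comp: "component (v \<kappa> a) = \<kappa>" "position (v \<kappa> a) = a" for \<kappa> a
    by (cases \<kappa>; simp add: v_def)+
  have edge: "{v \<kappa> (2 * q), v \<kappa> (2 * q + 1)} \<in> edges ?H" if "(\<kappa>, q) \<in> ?M" for \<kappa> q
  proof (cases \<kappa>)
    case (Inl i)
    then have i: "i \<in> {1..r}" "2 * q + 1 < l i"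
      using that by (auto simp: components_def odd_width_def)
    then have "{2 * q, 2 * q + 1} \<in> edges (path_graph (l i))" unfolding path_graph_def by auto
    then have "Inl ` Pair i ` {2 * q, 2 * q + 1} \<in> edges ?H"
      unfolding paths_and_cycles_def disjoint_union_def disjoint_Union_def snd_conv
      by (intro UnI1 imageI UN_I[OF i(1)])
    then show ?thesis using Inl by (simp add: v_def)
  next
    case (Inr j)
    then have j: "j \<in> {1..s}" "2 * q + 1 < 2 * m j"
      using that by (auto simp: components_def odd_width_def)
    then have "{2 * q, 2 * q + 1} \<in> edges (cycle_graph (2 * m j))"
      unfolding cycle_graph_def by (auto intro!: exI[of _ "2 * q"])
    then have "Inr ` Pair j ` {2 * q, 2 * q + 1} \<in> edges ?H"
      unfolding paths_and_cycles_def disjoint_union_def disjoint_Union_def snd_conv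
      by (intro UnI2 imageI UN_I[OF j(1)])
    then show ?thesis using Inr by (simp add: v_def)
  qed
  then have M: "v \<kappa> (2 * q) \<in> verts ?H \<and> v \<kappa> (2 * q + 1) \<in> verts ?H \<and>
      {v \<kappa> (2 * q), v \<kappa> (2 * q + 1)} \<in> edges ?H" if "(\<kappa>, q) \<in> ?M" for \<kappa> q
    using that simple_paths_and_cycles[OF m] by (fastforce simp: simple_graph_def)
  have "\<exists>u. Inl u \<in> \<phi> ` {v \<kappa> (2 * q), v \<kappa> (2 * q + 1)}
      \<and> left_block_coloring b (\<phi> ` {v \<kappa> (2 * q), v \<kappa> (2 * q + 1)}) = u div b + 1"
    if "(\<kappa>, q) \<in> ?M" for \<kappa> q
  proof -
    have "\<phi> ` {v \<kappa> (2 * q), v \<kappa> (2 * q + 1)} \<in> edges (complete_bipartite n n')"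
      using edges M[OF that] F by blast
    then obtain u w where "\<phi> ` {v \<kappa> (2 * q), v \<kappa> (2 * q + 1)} = {Inl u, Inr w}"
      by (auto simp: complete_bipartite_def)
    then show ?thesis by (metis insertI1 left_block_coloring_edge(1))
  qed
  then obtain g where g: "Inl (g \<kappa> q) \<in> \<phi> ` {v \<kappa> (2 * q), v \<kappa> (2 * q + 1)}"
      "left_block_coloring b (\<phi> ` {v \<kappa> (2 * q), v \<kappa> (2 * q + 1)}) = g \<kappa> q div b + 1"
    if "(\<kappa>, q) \<in> ?M" for \<kappa> q
    by metis
  have cardM: "card ?M = sum (odd_width l m) (components r s)" using finite_components by simp
  then have "?M \<noteq> {}" using b(2) by (metis card.empty not_less0)
  then obtain \<kappa>\<^sub>0 q\<^sub>0 where M0: "(\<kappa>\<^sub>0, q\<^sub>0) \<in> ?M" by auto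
  define i where "i = g \<kappa>\<^sub>0 q\<^sub>0 div b"
  have "g \<kappa> q div b = i" if "(\<kappa>, q) \<in> ?M" for \<kappa> q
    using mono edges M[OF that] M[OF M0] g(2)[OF that] g(2)[OF M0]
    unfolding monochromatic_def i_def by (metis add_right_cancel)
  then have "g \<kappa> q \<in> {i * b..<i * b + b}" if "(\<kappa>, q) \<in> ?M" for \<kappa> q
    using that b(1) by (metis add.commute atLeastLessThan_iff div_times_less_eq_dividend dividend_less_div_times)
  then have "(\<lambda>(\<kappa>, q). g \<kappa> q) ` ?M \<subseteq> {i * b..<i * b + b}" by auto
  moreover have "inj_on (\<lambda>(\<kappa>, q). g \<kappa> q) ?M"
  proof (rule inj_onI)
    have eq: "\<kappa> = \<kappa>' \<and> q = q'"
      if h: "(\<kappa>, q) \<in> ?M" "(\<kappa>', q') \<in> ?M" "g \<kappa> q = g \<kappa>' q'" for \<kappa> q \<kappa>' q'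
    proof -
      obtain a where a: "a \<in> {v \<kappa> (2 * q), v \<kappa> (2 * q + 1)}" "Inl (g \<kappa> q) = \<phi> a"
        using g(1)[OF h(1)] by blast
      obtain a' where a': "a' \<in> {v \<kappa>' (2 * q'), v \<kappa>' (2 * q' + 1)}" "Inl (g \<kappa>' q') = \<phi> a'"
        using g(1)[OF h(2)] by blast
      have "a = a'"
        using inj_onD[OF inj, of a a'] a a' h(3) M[OF h(1)] M[OF h(2)] by auto
      then have "component a = component a'" "position a div 2 = position a' div 2" by simp_all
      then show ?thesis using a(1) a'(1) comp by auto
    qed
    fix x y assume "x \<in> ?M" "y \<in> ?M" "(case x of (\<kappa>, q) \<Rightarrow> g \<kappa> q) = (case y of (\<kappa>, q) \<Rightarrow> g \<kappa> q)"
    then show "x = y"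
      using eq[of "fst x" "snd x" "fst y" "snd y"] by (simp add: prod_eq_iff case_prod_unfold)
  qed
  ultimately have "card ?M \<le> card {i * b..<i * b + b}" by (metis card_image card_mono finite_atLeastLessThan)
  then show False using b(2) cardM by simp
qed

section \<open>The bipartite Gallai-Ramsey number\<close>

theorem theorem3p4:
  fixes r s k :: nat and l m :: "nat \<Rightarrow> nat"
  assumes rs: "\<not> (r = 0 \<and> s = 0)"
    and l: "\<And>i. 1 \<le> i \<Longrightarrow> i \<le> r \<Longrightarrow> l i \<ge> 2"
    and m: "\<And>j. 1 \<le> j \<Longrightarrow> j \<le> s \<Longrightarrow> m j \<ge> 2"
    and k: "k \<ge> 2 + (\<Sum>i=1..r. (l i div 2 + 1)) + (\<Sum>j=1..s. m j)"
    and nondegenerate: "\<not> (r = 1 \<and> s = 0 \<and> l 1 \<le> 3)"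
  shows "bgr k (path_graph 5)
           (disjoint_union (disjoint_Union {1..r} (\<lambda>i. path_graph (l i)))
                           (disjoint_Union {1..s} (\<lambda>j. cycle_graph (2 * m j))))
         = enat (k * ((\<Sum>i=1..r. l i div 2) + (\<Sum>j=1..s. m j)) - k + 1)"
proof -
  define t where "t = (\<Sum>i=1..r. l i div 2) + (\<Sum>j=1..s. m j)"
  define q where "q = sum (even_width l m) (components r s)"
  have t_odd: "t = sum (odd_width l m) (components r s)"
    by (simp add: t_def sum_components odd_width_def)
  have kq: "q + 2 \<le> k" using k by (simp add: q_def sum_components even_width_def)
  \<comment> \<open>Excluding a single path with at most three vertices excludes exactly \<open>t = 1\<close>.\<close>
  have t2: "2 \<le> t"
  proof (cases "s = 0")
    case False
    then have "m 1 \<le> (\<Sum>j=1..s. m j)" by (intro member_le_sum) auto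
    then show ?thesis using m[of 1] False by (simp add: t_def)
  next
    case True
    show ?thesis
    proof (cases "r = 1")
      case True
      then show ?thesis using nondegenerate \<open>s = 0\<close> by (simp add: t_def)
    next
      case False
      have "(\<Sum>i=1..r. 1) \<le> (\<Sum>i=1..r. l i div 2)" using l by (intro sum_mono) fastforce
      then show ?thesis using rs True False by (simp add: t_def)
    qed
  qed
  let ?n = "k * (t - 1)" and ?H = "paths_and_cycles r s l m"
  have upper: "bgr_admissible k (path_graph 5) ?H (?n + 1)"
    unfolding bgr_admissible_def
  proof (intro conjI allI impI)
    have "k * 1 \<le> ?n" using t2 by (intro mult_le_mono) auto
    then have "k \<le> ?n + 1" by linarith
    also have "\<dots> \<le> (?n + 1) ^ 2" by (rule self_le_power) simp_all
    finally show "k \<le> (?n + 1) ^ 2" .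
    fix N c assume N: "?n + 1 \<le> N" and exact: "exact_edge_coloring k (complete_bipartite N N) c"
    then show "(\<exists>F. copy_in F (path_graph 5) (complete_bipartite N N) \<and> rainbow c F) \<or>
      (\<exists>F. copy_in F ?H (complete_bipartite N N) \<and> monochromatic c F)"
      using monochromatic_copy_exists[OF l m q_def t_odd t2 kq _ exact] by fastforce
  qed
  have lower: "?n + 1 \<le> n" if n: "bgr_admissible k (path_graph 5) ?H n" for n
  proof (rule ccontr)
    assume "\<not> ?thesis"
    then have "n \<le> ?n" by simp
    moreover have "exact_edge_coloring k (complete_bipartite ?n ?n) (left_block_coloring (t - 1))"
      using kq t2 by (intro left_block_coloring_exact) auto
    ultimately obtain F
      where "copy_in F (path_graph 5) (complete_bipartite ?n ?n) \<and> rainbow (left_block_coloring (t - 1)) F \<or>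
        copy_in F ?H (complete_bipartite ?n ?n) \<and> monochromatic (left_block_coloring (t - 1)) F"
      using n unfolding bgr_admissible_def by blast
    then show False
      using left_block_coloring_no_rainbow[of F ?n ?n "t - 1"]
        left_block_coloring_no_monochromatic[where m = m and l = l and r = r and s = s
          and b = "t - 1" and F = F, OF m] t2 t_odd by auto
  qed
  have "bgr k (path_graph 5) ?H = enat (?n + 1)"
    unfolding bgr_def
  proof (rule antisym)
    show "Inf (enat ` {n. bgr_admissible k (path_graph 5) ?H n}) \<le> enat (?n + 1)"
      using upper by (intro Inf_lower) blast
    show "enat (?n + 1) \<le> Inf (enat ` {n. bgr_admissible k (path_graph 5) ?H n})"
      using lower by (intro Inf_greatest) auto
  qed
  moreover have "?n + 1 = k * t - k + 1" by (simp add: diff_mult_distrib2)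
  ultimately show ?thesis unfolding paths_and_cycles_def t_def by metis
qed

end
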